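(* Let $\varphi:[0,\infty)\to[0,\infty)$ be an increasing continuous function with $\varphi(0)=0$ and $r/\varphi(r)\to 0$ as $r\to 0$. Then there exists a compact set $K\subset[0,1]$ such that $\mathcal H^{\varphi}(K)>0$ and $K$ is an absolutely normal set of uniqueness.
   Context: For an increasing continuous $\varphi:[0,\infty)\to[0,\infty)$ with $\varphi(0)=0$ (a gauge function), the Hausdorff measure is $\mathcal H^\varphi(E)=\lim_{\delta\to0}\mathcal H^\varphi_\delta(E)$ with $\mathcal H^\varphi_\delta(E)=\inf\{\sum_{i}\varphi(|U_i|): E\subset\bigcup_{i=1}^\infty U_i,\ |U_i|\le\delta\}$, where $|U|$ is the diameter of $U$. A set $E\subset[0,1]$ is a set of uniqueness if $\sum_{n=0}^\infty (a_n\cos(2\pi nx)+b_n\sin(2\pi nx))=0$ for all $x\in[0,1]\setminus E$ implies that $a_n=b_n=0$ for each $n$ (where for $n=0$ only $a_0$ is relevant). A real number $x$ is $b$-normal if the sequence of fractional parts $\{b^kx\}_{k\ge1}$ is equidistributed in $[0,1]$ with respect to Lebesgue measure; $x$ is absolutely normal if it is $b$-normal for every integer $b\ge2$. $\mathbb A$ denotes the (Borel) set of absolutely normal real numbers. A compact set $E$ is an absolutely normal set of uniqueness if $E$ is a set of uniqueness, $\mathbb A\cap E$ is dense in $E$, and $\dim_{\mathrm H}(E)=\dim_{\mathrm H}(E\cap\mathbb A)$, where $\dim_{\mathrm H}$ is Hausdorff dimension. *)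

theory Defs
  imports "HOL-Analysis.Analysis"
begin

section \<open>Hausdorff measures and Hausdorff dimension\<close>

text \<open>
  The library's \<^const>\<open>diameter\<close> is an unspecified real number for unbounded sets, so boundedness of
  the covering sets, implicit in \<open>|U\<^sub>i| \<le> \<delta>\<close>, is required explicitly. The covering sets may be
  empty; empty sets have diameter 0.
\<close>

definition hausdorff_premeasure :: "(real \<Rightarrow> real) \<Rightarrow> real \<Rightarrow> 'a::metric_space set \<Rightarrow> ennreal" where
  "hausdorff_premeasure \<phi> \<delta> E =
     (INF U \<in> {U :: nat \<Rightarrow> 'a set. E \<subseteq> (\<Union>i. U i) \<and> (\<forall>i. bounded (U i) \<and> diameter (U i) \<le> \<delta>)}.
        \<Sum>i. ennreal (\<phi> (diameter (U i))))"

definition hausdorff_measure :: "(real \<Rightarrow> real) \<Rightarrow> 'a::metric_space set \<Rightarrow> ennreal" where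
  "hausdorff_measure \<phi> E = Lim (at_right 0) (\<lambda>\<delta>. hausdorff_premeasure \<phi> \<delta> E)"

lemma hausdorff_premeasure_antimono:
  assumes "\<delta> \<le> \<delta>'"
  shows "hausdorff_premeasure \<phi> \<delta>' E \<le> hausdorff_premeasure \<phi> \<delta> E"
  unfolding hausdorff_premeasure_def
  by (rule INF_superset_mono) (use assms in \<open>auto intro: order_trans\<close>)

lemma tendsto_hausdorff_premeasure:
  "((\<lambda>\<delta>. hausdorff_premeasure \<phi> \<delta> E) \<longlongrightarrow> (SUP \<delta>\<in>{0<..}. hausdorff_premeasure \<phi> \<delta> E)) (at_right 0)"
proof (rule order_tendstoI)
  fix a assume "a < (SUP \<delta>\<in>{0<..}. hausdorff_premeasure \<phi> \<delta> E)"
  then obtain d where d: "d > 0" "a < hausdorff_premeasure \<phi> d E"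
    by (auto simp: less_SUP_iff)
  have "a < hausdorff_premeasure \<phi> \<delta> E" if "\<delta> < d" for \<delta>
    using d hausdorff_premeasure_antimono[of \<delta> d \<phi> E] that by (meson less_imp_le order_less_le_trans)
  with d show "\<forall>\<^sub>F \<delta> in at_right 0. a < hausdorff_premeasure \<phi> \<delta> E"
    by (auto simp: eventually_at_right_field)
next
  fix a assume a: "(SUP \<delta>\<in>{0<..}. hausdorff_premeasure \<phi> \<delta> E) < a"
  have "hausdorff_premeasure \<phi> \<delta> E < a" if "\<delta> > 0" for \<delta>
    using that by (intro le_less_trans[OF SUP_upper a]) auto
  then show "\<forall>\<^sub>F \<delta> in at_right 0. hausdorff_premeasure \<phi> \<delta> E < a"
    by (auto simp: eventually_at_right_field intro: exI[of _ 1])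
qed

lemma hausdorff_measure_eq_SUP:
  "hausdorff_measure \<phi> E = (SUP \<delta>\<in>{0<..}. hausdorff_premeasure \<phi> \<delta> E)"
  unfolding hausdorff_measure_def
  by (rule tendsto_Lim[OF trivial_limit_at_right_real tendsto_hausdorff_premeasure])

text \<open>
  Restricting the infimum to \<open>s > 0\<close> does not change it and avoids the convention for \<open>0\<^sup>0\<close>
  needed to make the case \<open>s = 0\<close> the counting measure.
\<close>

definition hausdorff_dim :: "'a::metric_space set \<Rightarrow> ereal" where
  "hausdorff_dim E = Inf {ereal s | s. 0 < s \<and> hausdorff_measure (\<lambda>r. r powr s) E = 0}"


section \<open>Sets of uniqueness\<close>

definition set_of_uniqueness :: "real set \<Rightarrow> bool" where
  "set_of_uniqueness E \<longleftrightarrow>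
     E \<subseteq> {0..1} \<and>
     (\<forall>a b :: nat \<Rightarrow> real.
        (\<forall>x \<in> {0..1} - E. (\<lambda>n. a n * cos (2 * pi * real n * x) + b n * sin (2 * pi * real n * x)) sums 0)
        \<longrightarrow> (\<forall>n. a n = 0) \<and> (\<forall>n\<ge>1. b n = 0))"


section \<open>Normal numbers\<close>

text \<open>Only the terms with index \<open>k \<ge> 1\<close> matter.\<close>

definition equidistributed01 :: "(nat \<Rightarrow> real) \<Rightarrow> bool" where
  "equidistributed01 X \<longleftrightarrow>
     (\<forall>c d. 0 \<le> c \<and> c \<le> d \<and> d \<le> 1 \<longrightarrow>
        (\<lambda>N. real (card {k \<in> {1..N}. X k \<in> {c..d}}) / real N) \<longlonglongrightarrow> measure lebesgue {c..d})"

definition normal_to_base :: "nat \<Rightarrow> real \<Rightarrow> bool" where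
  "normal_to_base b x \<longleftrightarrow> equidistributed01 (\<lambda>k. frac (real b ^ k * x))"

definition absolutely_normal_numbers :: "real set" where
  "absolutely_normal_numbers = {x. \<forall>b\<ge>2. normal_to_base b x}"

definition absolutely_normal_set_of_uniqueness :: "real set \<Rightarrow> bool" where
  "absolutely_normal_set_of_uniqueness E \<longleftrightarrow>
     compact E \<and> set_of_uniqueness E \<and>
     E \<subseteq> closure (absolutely_normal_numbers \<inter> E) \<and>
     hausdorff_dim E = hausdorff_dim (E \<inter> absolutely_normal_numbers)"

end

theory Submission
  imports Defs
begin

text \<open>
  Since almost every number is absolutely normal, there is a compact set \<open>K\<^sub>0\<close> of positive
  Lebesgue measure consisting of absolutely normal numbers only; every subset of \<open>K\<^sub>0\<close> trivially
  meets the density and dimension requirements. Put \<open>K\<^sub>k\<^sub>+\<^sub>1 = K\<^sub>k \<inter> {x. cos (2 \<pi> n\<^sub>k x) \<ge> 0}\<close> for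
  rapidly growing \<open>n\<^sub>k\<close>. Each step halves the Lebesgue measure of the part of \<open>K\<^sub>k\<close> in any given
  interval in the limit \<open>n\<^sub>k \<rightarrow> \<infinity>\<close>, so that the measures \<open>2\<^sup>k\<close> times Lebesgue on \<open>K\<^sub>k\<close> keep
  their total mass, and they give intervals of length \<open>r\<close> mass at most a constant times \<open>\<phi> r\<close>,
  because \<open>2\<^sup>k\<^sup>+\<^sup>1 r \<le> \<phi> r\<close> at the small scales \<open>r\<close> where step \<open>k\<close> changes masses appreciably.
  Hence \<open>\<Inter>K\<^sub>k\<close> has positive \<open>\<phi>\<close>-measure.

  The intersection is an H-set in the sense of Rajchman. Cantor's theorem (via Baire) makes the
  coefficients of a trigonometric series vanishing off it tend to 0. Riemann's second primitive
  \<open>F\<close> of the series is affine on every interval where the series converges to 0, so second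
  differences of \<open>F\<close> vanish at the points \<open>(j + 1/2) / n\<close>, \<open>j < n\<close>, for infinitely many \<open>n\<close>.
  Averaging these over \<open>j\<close> against \<open>exp (- 2 \<pi> i p x)\<close> isolates the frequencies congruent to
  \<open>p\<close> or \<open>- p\<close> modulo \<open>n\<close>, of which only \<open>p\<close> itself survives as \<open>n \<rightarrow> \<infinity>\<close>.
\<close>

section \<open>Riemann summation and generalised second derivatives\<close>

text \<open>The kernel of Riemann's (R,2) summation method, with the removable singularity at 0
  filled in.\<close>

definition riemann_kernel :: "real \<Rightarrow> real" where
  "riemann_kernel t = (if t = 0 then 1 else (sin t / t)\<^sup>2)"

lemma riemann_kernel_0 [simp]: "riemann_kernel 0 = 1"
  by (simp add: riemann_kernel_def)

lemma riemann_kernel_nonneg: "0 \<le> riemann_kernel t"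
  by (simp add: riemann_kernel_def)

lemma riemann_kernel_le_1: "riemann_kernel t \<le> 1"
proof -
  have "\<bar>sin t\<bar> \<le> \<bar>t\<bar>" by (rule abs_sin_x_le_abs_x)
  then have "(sin t)\<^sup>2 \<le> t\<^sup>2" by (simp add: abs_le_square_iff)
  then show ?thesis by (simp add: riemann_kernel_def power_divide)
qed

lemma riemann_kernel_le_inverse_square: "t \<noteq> 0 \<Longrightarrow> riemann_kernel t \<le> 1 / t\<^sup>2"
  by (simp add: riemann_kernel_def power_divide divide_right_mono abs_square_le_1)

lemma isCont_riemann_kernel_0: "isCont riemann_kernel 0"
proof -
  have "((\<lambda>t::real. (sin t / t)\<^sup>2) \<longlongrightarrow> 1\<^sup>2) (at 0)"
    by (intro tendsto_power) (use DERIV_D[OF DERIV_sin[of 0]] in simp)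
  then have "(riemann_kernel \<longlongrightarrow> 1) (at 0)"
    by (simp add: riemann_kernel_def cong: LIM_cong)
  then show ?thesis by (simp add: isCont_def)
qed

lemma isCont_riemann_kernel: "isCont riemann_kernel t"
proof (cases "t = 0")
  case False
  have "isCont (\<lambda>t. (sin t / t)\<^sup>2) t"
    using False by (intro continuous_intros)
  moreover have "\<forall>\<^sub>F x in nhds t. riemann_kernel x = (sin x / x)\<^sup>2"
    using eventually_nhds_in_open[of "-{0}" t] False
    by (auto simp: riemann_kernel_def elim!: eventually_mono)
  ultimately show ?thesis by (simp add: isCont_cong)
qed (simp add: isCont_riemann_kernel_0)

text \<open>For either sign \<open>s\<close>, the function
  \<open>s * (t * cos t - sin t) - t\<^sup>2\<close> vanishes at 0 and has derivative
  \<open>- s * t * sin t - 2 * t\<close>, at most 0. The estimate tames the numerator of the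
  derivative of \<open>riemann_kernel\<close> near 0.\<close>

lemma abs_x_cos_minus_sin_le:
  assumes "0 \<le> (t::real)"
  shows "\<bar>t * cos t - sin t\<bar> \<le> t\<^sup>2"
proof -
  have *: "\<exists>D. ((\<lambda>t. s * (t * cos t - sin t) - t\<^sup>2) has_real_derivative D) (at x) \<and> D \<le> 0"
    if "0 \<le> x" "s = 1 \<or> s = -1" for s x :: real
  proof -
    have "\<bar>x * sin x\<bar> \<le> x" using that by (simp add: abs_mult mult_left_le)
    then have "s * (cos x - x * sin x - cos x) - 2 * x \<le> 0"
      using that by auto
    then show ?thesis
      by (intro exI[of _ "s * (cos x - x * sin x - cos x) - 2 * x"])
        (auto intro!: derivative_eq_intros)
  qed
  have "s * (t * cos t - sin t) - t\<^sup>2 \<le> s * (0 * cos 0 - sin 0) - 0\<^sup>2"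
    if "s = 1 \<or> s = -1" for s :: real
    using DERIV_nonpos_imp_nonincreasing[OF assms *[OF _ that]] by auto
  from this[of 1] this[of "-1"] show ?thesis by auto
qed

text \<open>The derivative of the kernel is dominated by that of \<open>6 * arctan\<close>. Since
  \<open>arctan\<close> is bounded, the total variation over the half line is finite, which is what
  summation by parts needs.\<close>

lemma riemann_kernel_variation:
  assumes "0 \<le> t" "t \<le> u"
  shows "\<bar>riemann_kernel t - riemann_kernel u\<bar> \<le> 6 * arctan u - 6 * arctan t"
proof -
  define D where "D x = 2 * sin x * (x * cos x - sin x) / x ^ 3" for x :: real
  have der: "(riemann_kernel has_real_derivative D x) (at x)" if "0 < x" for x
  proof -
    have "((\<lambda>t. (sin t / t)\<^sup>2) has_real_derivative D x) (at x)"
      using that unfolding D_def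
      by (auto intro!: derivative_eq_intros simp: field_simps power2_eq_square power3_eq_cube)
    then show ?thesis
      by (rule has_field_derivative_transform_within_open[where S = "{0<..}"])
        (use that in \<open>auto simp: riemann_kernel_def\<close>)
  qed
  \<comment> \<open>Two estimates are added: \<open>\<bar>D x\<bar> \<le> 2\<close>, useful near 0,
    and \<open>\<bar>D x\<bar> * x\<^sup>2 \<le> 4\<close>, useful far out; hence the constant
    6.\<close>
  have bound: "\<bar>D x\<bar> \<le> 6 / (1 + x\<^sup>2)" if x: "0 < x" for x
  proof -
    have s: "\<bar>sin x\<bar> \<le> x" using abs_sin_x_le_abs_x[of x] x by simp
    have "\<bar>sin x * (x * cos x - sin x)\<bar> \<le> x * x\<^sup>2"
      unfolding abs_mult by (intro mult_mono s abs_x_cos_minus_sin_le) (use x in auto)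
    then have 1: "\<bar>D x\<bar> \<le> 2"
      using x by (simp add: D_def abs_mult field_simps power3_eq_cube power2_eq_square)
    have "\<bar>x * cos x - sin x\<bar> \<le> \<bar>x * cos x\<bar> + \<bar>sin x\<bar>" by (rule abs_triangle_ineq4)
    also have "\<dots> \<le> x + x" by (intro add_mono s) (use x in \<open>simp add: abs_mult mult_left_le\<close>)
    finally have "\<bar>sin x\<bar> * \<bar>x * cos x - sin x\<bar> \<le> 1 * (2 * x)"
      by (intro mult_mono) auto
    then have "2 * (\<bar>sin x\<bar> * \<bar>x * cos x - sin x\<bar>) / x \<le> 4"
      using x by (simp add: pos_divide_le_eq)
    also have "2 * (\<bar>sin x\<bar> * \<bar>x * cos x - sin x\<bar>) / x = \<bar>D x\<bar> * x\<^sup>2"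
      using x by (simp add: D_def abs_mult power3_eq_cube power2_eq_square)
    finally have "\<bar>D x\<bar> * x\<^sup>2 \<le> 4" .
    with 1 have "\<bar>D x\<bar> * (1 + x\<^sup>2) \<le> 6" by (simp add: algebra_simps)
    then show ?thesis by (simp add: pos_le_divide_eq add_pos_nonneg)
  qed
  \<comment> \<open>The two signs together give the absolute value. \<open>der\<close> covers
    positive points only while \<open>t\<close> may be 0, hence the monotonicity criterion with
    derivatives on the open interval.\<close>
  have "6 * arctan t + s * riemann_kernel t \<le> 6 * arctan u + s * riemann_kernel u"
    if s: "s = 1 \<or> s = -1" for s
  proof (cases "t = u")
    case False
    show ?thesis
    proof (rule DERIV_nonneg_imp_increasing_open[where f = "\<lambda>x. 6 * arctan x + s * riemann_kernel x"])
      fix x assume "t < x" "x < u"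
      then have x: "0 < x" using assms by simp
      have "((\<lambda>x. 6 * arctan x + s * riemann_kernel x) has_real_derivative 6 * inverse (1 + x\<^sup>2) + s * D x) (at x)"
        by (auto intro!: derivative_eq_intros der x)
      moreover have "0 \<le> 6 * inverse (1 + x\<^sup>2) + s * D x"
        using bound[OF x] s by (auto simp: divide_inverse)
      ultimately show "\<exists>y. ((\<lambda>x. 6 * arctan x + s * riemann_kernel x) has_real_derivative y) (at x) \<and> 0 \<le> y"
        by blast
    qed (use assms in \<open>auto intro!: continuous_at_imp_continuous_on continuous_intros isCont_riemann_kernel\<close>)
  qed simp
  from this[of 1] this[of "-1"] show ?thesis by auto
qed

text \<open>Abel's summation by parts.\<close>

lemma sum_mult_riemann_kernel:
  fixes u :: "nat \<Rightarrow> real"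
  shows "(\<Sum>m<N. u m * riemann_kernel (real m * h)) =
    (\<Sum>m<N. u m) * riemann_kernel (real N * h) +
    (\<Sum>m<N. (\<Sum>i<Suc m. u i) * (riemann_kernel (real m * h) - riemann_kernel (real (Suc m) * h)))"
  by (induction N) (simp_all add: algebra_simps)

text \<open>After summation by parts, partial sums multiply increments of the kernel. The early
  partial sums are merely bounded, but over that range the kernel varies little for small
  \<open>h\<close>; the later ones are small, and the total variation is bounded independently of
  \<open>h\<close>.\<close>

lemma riemann_summation:
  fixes u :: "nat \<Rightarrow> real"
  assumes "u sums 0" "\<And>h. h > 0 \<Longrightarrow> summable (\<lambda>m. u m * riemann_kernel (real m * h))"
  shows "((\<lambda>h. \<Sum>m. u m * riemann_kernel (real m * h)) \<longlongrightarrow> 0) (at_right 0)"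
proof (rule tendstoI)
  fix e :: real assume e: "e > 0"
  define S where "S N = (\<Sum>m<N. u m)" for N
  have S: "S \<longlonglongrightarrow> 0" using assms(1) by (simp add: sums_def S_def[abs_def])
  then obtain B where B: "B > 0" "\<And>N. \<bar>S N\<bar> \<le> B"
    using Bseq_def[of S] convergent_imp_Bseq[of S] by (auto simp: convergent_def)
  \<comment> \<open>The final estimate is \<open>22 * \<epsilon>\<close>: one for the boundary term,
    one for the head, and twenty for the total variation, as \<open>6 * arctan\<close> stays below
    20.\<close>
  define \<epsilon> where "\<epsilon> = e / 40"
  have \<epsilon>: "\<epsilon> > 0" using e by (simp add: \<epsilon>_def)
  obtain M where M: "\<And>N. N \<ge> M \<Longrightarrow> \<bar>S N\<bar> < \<epsilon>"
    using LIMSEQ_D[OF S \<epsilon>] by auto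
  have "((\<lambda>h. B * (6 * arctan (real M * h))) \<longlongrightarrow> B * (6 * arctan (real M * 0))) (at_right 0)"
    by (intro tendsto_intros)
  then have "\<forall>\<^sub>F h in at_right 0. B * (6 * arctan (real M * h)) < \<epsilon>"
    by (rule order_tendstoD) (use \<epsilon> in simp)
  moreover have "\<forall>\<^sub>F h::real in at_right 0. h > 0"
    by (simp add: eventually_at_filter)
  ultimately show "\<forall>\<^sub>F h in at_right 0. dist (\<Sum>m. u m * riemann_kernel (real m * h)) 0 < e"
  proof eventually_elim
    case (elim h)
    define \<Psi> where "\<Psi> m = 6 * arctan (real m * h)" for m
    have mono: "\<Psi> m \<le> \<Psi> (Suc m)" for m
      using elim by (simp add: \<Psi>_def arctan_le_iff algebra_simps)
    have bound: "\<bar>\<Sum>m<N. u m * riemann_kernel (real m * h)\<bar> \<le> \<epsilon> + (\<epsilon> + \<epsilon> * 20)" if N: "N \<ge> M" for N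
    proof -
      have "\<bar>S N * riemann_kernel (real N * h)\<bar> \<le> \<epsilon> * 1"
        unfolding abs_mult using M[OF N] riemann_kernel_nonneg riemann_kernel_le_1
        by (intro mult_mono) auto
      moreover have "\<bar>\<Sum>m<N. S (Suc m) * (riemann_kernel (real m * h) - riemann_kernel (real (Suc m) * h))\<bar>
          \<le> (\<Sum>m<N. ((if m < M then B else 0) + \<epsilon>) * (\<Psi> (Suc m) - \<Psi> m))"
      proof (rule order_trans[OF sum_abs sum_mono])
        fix m
        have 1: "\<bar>S (Suc m)\<bar> \<le> (if m < M then B else 0) + \<epsilon>"
          using B(2)[of "Suc m"] M[of "Suc m"] \<epsilon> by auto
        have 2: "\<bar>riemann_kernel (real m * h) - riemann_kernel (real (Suc m) * h)\<bar> \<le> \<Psi> (Suc m) - \<Psi> m"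
          unfolding \<Psi>_def using elim by (intro riemann_kernel_variation) (auto simp: algebra_simps)
        show "\<bar>S (Suc m) * (riemann_kernel (real m * h) - riemann_kernel (real (Suc m) * h))\<bar>
            \<le> ((if m < M then B else 0) + \<epsilon>) * (\<Psi> (Suc m) - \<Psi> m)"
          unfolding abs_mult using B(1) \<epsilon> by (intro mult_mono 1 2) auto
      qed
      moreover have "(\<Sum>m<N. ((if m < M then B else 0) + \<epsilon>) * (\<Psi> (Suc m) - \<Psi> m)) \<le> \<epsilon> + \<epsilon> * 20"
      proof -
        have "(\<Sum>m<N. (if m < M then B else 0) * (\<Psi> (Suc m) - \<Psi> m)) =
            (\<Sum>m<M. B * (\<Psi> (Suc m) - \<Psi> m))"
          using N by (intro sum.mono_neutral_cong_right) auto
        also have "\<dots> = B * \<Psi> M"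
          by (simp add: sum_distrib_left[symmetric] sum_lessThan_telescope) (simp add: \<Psi>_def)
        also have "\<dots> \<le> \<epsilon>" using elim by (simp add: \<Psi>_def)
        finally have "(\<Sum>m<N. (if m < M then B else 0) * (\<Psi> (Suc m) - \<Psi> m)) \<le> \<epsilon>" .
        moreover have "(\<Sum>m<N. \<epsilon> * (\<Psi> (Suc m) - \<Psi> m)) = \<epsilon> * \<Psi> N"
          by (simp add: sum_distrib_left[symmetric] sum_lessThan_telescope) (simp add: \<Psi>_def)
        moreover have "\<Psi> N \<le> 20"
          using arctan_ubound[of "real N * h"] pi_less_4 by (simp add: \<Psi>_def)
        moreover from this have "\<epsilon> * \<Psi> N \<le> \<epsilon> * 20" using \<epsilon> by (intro mult_left_mono) auto
        ultimately show ?thesis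
          unfolding distrib_right sum.distrib by linarith
      qed
      ultimately show ?thesis
        unfolding sum_mult_riemann_kernel by (simp add: S_def)
    qed
    have "(\<lambda>N. \<bar>\<Sum>m<N. u m * riemann_kernel (real m * h)\<bar>) \<longlonglongrightarrow> \<bar>\<Sum>m. u m * riemann_kernel (real m * h)\<bar>"
      using assms(2)[of h] elim by (intro tendsto_intros summable_LIMSEQ) auto
    then have "\<bar>\<Sum>m. u m * riemann_kernel (real m * h)\<bar> \<le> \<epsilon> + (\<epsilon> + \<epsilon> * 20)"
      by (rule LIMSEQ_le_const2) (use bound in auto)
    also have "\<dots> < e" using e by (simp add: \<epsilon>_def)
    finally show ?case by simp
  qed
qed

section \<open>Schwarz's theorem on the second symmetric derivative\<close>

text \<open>Adding the convex quadratic \<open>\<epsilon> * (x - a) * (x - b)\<close> makes the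
  second symmetric derivative \<open>2 * \<epsilon>\<close>, whereas second differences at an
  interior maximum are at most 0. So the maximum sits at an end point, where the value is 0.\<close>

lemma schwarz_nonpos:
  fixes F :: "real \<Rightarrow> real"
  assumes cont: "continuous_on {a..b} F" and "F a = 0" "F b = 0"
    and D: "\<And>x. \<lbrakk>a < x; x < b\<rbrakk> \<Longrightarrow>
      ((\<lambda>h. (F (x + h) + F (x - h) - 2 * F x) / h\<^sup>2) \<longlongrightarrow> 0) (at_right 0)"
    and x: "x \<in> {a..b}"
  shows "F x \<le> 0"
proof (rule field_le_epsilon)
  fix e :: real assume e: "e > 0"
  \<comment> \<open>The quadratic then costs at most \<open>e\<close>; the summand 1 keeps the
    divisor positive when \<open>a = b\<close>.\<close>
  define \<epsilon> where "\<epsilon> = e / (1 + (b - a)\<^sup>2)"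
  have \<epsilon>: "\<epsilon> > 0" using e by (simp add: \<epsilon>_def add_pos_nonneg)
  define G where "G x = F x + \<epsilon> * (x - a) * (x - b)" for x
  have "continuous_on {a..b} G" unfolding G_def by (intro continuous_intros cont)
  then obtain z where z: "z \<in> {a..b}" "\<And>y. y \<in> {a..b} \<Longrightarrow> G y \<le> G z"
    using continuous_attains_sup[of "{a..b}" G] x by auto
  have "G z \<le> 0"
  proof (cases "z = a \<or> z = b")
    case True
    then show ?thesis using assms by (auto simp: G_def)
  next
    case False
    then have z': "a < z" "z < b" using z by auto
    have "\<forall>\<^sub>F h in at_right 0. (F (z + h) + F (z - h) - 2 * F z) / h\<^sup>2 > - (2 * \<epsilon>)"
      using order_tendstoD(1)[OF D[OF z']] \<epsilon> by simp
    moreover have "\<forall>\<^sub>F h in at_right 0. h < min (z - a) (b - z)"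
      using z' by (intro eventually_at_right_less[THEN eventually_mono] order_tendstoD(2)[OF tendsto_ident_at]) auto
    moreover have "\<forall>\<^sub>F h::real in at_right 0. h > 0"
      by (simp add: eventually_at_filter)
    ultimately have "\<forall>\<^sub>F h::real in at_right 0. False"
    proof eventually_elim
      case (elim h)
      have "G (z + h) \<le> G z" "G (z - h) \<le> G z" using elim by (auto intro!: z)
      moreover have "G (z + h) + G (z - h) - 2 * G z = F (z + h) + F (z - h) - 2 * F z + 2 * \<epsilon> * h\<^sup>2"
        by (simp add: G_def algebra_simps power2_eq_square)
      ultimately have "F (z + h) + F (z - h) - 2 * F z \<le> - (2 * \<epsilon>) * h\<^sup>2" by simp
      then show ?case using elim by (simp add: field_simps)
    qed
    then show ?thesis by simp
  qed
  then have "G x \<le> 0" using z(2)[OF x] by simp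
  then have "F x \<le> \<epsilon> * ((x - a) * (b - x))" by (simp add: G_def algebra_simps)
  also have "(x - a) * (b - x) \<le> (b - a) * (b - a)" using x by (intro mult_mono) auto
  then have "\<epsilon> * ((x - a) * (b - x)) \<le> \<epsilon> * (1 + (b - a)\<^sup>2)"
    using \<epsilon> by (intro mult_left_mono) (auto simp: power2_eq_square)
  also have "\<dots> = e" unfolding \<epsilon>_def using zero_le_power2[of "b - a"]
    by (simp add: add_nonneg_eq_0_iff)
  finally show "F x \<le> 0 + e" by simp
qed

text \<open>The chord is subtracted and \<open>schwarz_nonpos\<close> applied to both signs of the
  difference. The midpoint is singled out because a second difference compares it with the end
  points.\<close>

lemma schwarz_affine:
  fixes F :: "real \<Rightarrow> real"
  assumes cont: "continuous_on {a..b} F" and "a < b"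
    and D: "\<And>x. \<lbrakk>a < x; x < b\<rbrakk> \<Longrightarrow>
      ((\<lambda>h. (F (x + h) + F (x - h) - 2 * F x) / h\<^sup>2) \<longlongrightarrow> 0) (at_right 0)"
  shows "F ((a + b) / 2) = (F a + F b) / 2"
proof -
  define c where "c = (F b - F a) / (b - a)"
  define G where "G s x = s * (F x - F a - c * (x - a))" for s x :: real
  have "G s ((a + b) / 2) \<le> 0" for s
  proof (rule schwarz_nonpos[of a b "G s"])
    have "continuous_on {a..b} (\<lambda>x. s * (F x - F a - c * (x - a)))" by (intro continuous_intros cont)
    then show "continuous_on {a..b} (G s)" by (simp add: G_def[abs_def])
  next
    fix x assume "a < x" "x < b"
    have "((\<lambda>h. s * ((F (x + h) + F (x - h) - 2 * F x) / h\<^sup>2)) \<longlongrightarrow> s * 0) (at_right 0)"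
      by (intro tendsto_intros D) fact+
    then show "((\<lambda>h. (G s (x + h) + G s (x - h) - 2 * G s x) / h\<^sup>2) \<longlongrightarrow> 0) (at_right 0)"
      by (simp add: G_def algebra_simps)
  qed (use \<open>a < b\<close> in \<open>auto simp: G_def c_def\<close>)
  from this[of 1] this[of "-1"] have "F ((a + b) / 2) - F a = c * ((a + b) / 2 - a)"
    by (simp add: G_def)
  also have "(a + b) / 2 - a = (b - a) / 2" by (simp add: field_simps)
  also have "c * ((b - a) / 2) = (F b - F a) / 2" using \<open>a < b\<close> by (simp add: c_def)
  finally show ?thesis by (simp add: field_simps)
qed


section \<open>Uniqueness for H-sets\<close>

definition trig_term :: "(nat \<Rightarrow> real) \<Rightarrow> (nat \<Rightarrow> real) \<Rightarrow> nat \<Rightarrow> real \<Rightarrow> real" where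
  "trig_term a b m x = a m * cos (2 * pi * real m * x) + b m * sin (2 * pi * real m * x)"

lemma abs_trig_term_le: "\<bar>trig_term a b m x\<bar> \<le> \<bar>a m\<bar> + \<bar>b m\<bar>"
proof -
  have "\<bar>trig_term a b m x\<bar> \<le> \<bar>a m * cos (2 * pi * real m * x)\<bar> + \<bar>b m * sin (2 * pi * real m * x)\<bar>"
    unfolding trig_term_def by (rule abs_triangle_ineq)
  also have "\<dots> \<le> \<bar>a m\<bar> + \<bar>b m\<bar>"
    by (intro add_mono) (simp_all add: abs_mult mult_left_le)
  finally show ?thesis .
qed

lemma continuous_on_trig_term [continuous_intros]: "continuous_on S (trig_term a b m)"
  unfolding trig_term_def[abs_def] by (intro continuous_intros)

text \<open>The interval contains a full period of the wave, so every phase occurs in it: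
  \<open>x\<close> solves \<open>m * x = t + j\<close> for the first integer \<open>j\<close> that
  does not put it to the left of \<open>p\<close>.\<close>

lemma trig_term_phase:
  assumes "real m * (q - p) \<ge> 1"
  obtains x where "x \<in> {p..q}" "trig_term a b m x = a m * cos (2 * pi * t) + b m * sin (2 * pi * t)"
proof
  have m: "real m > 0" using assms by (cases "m = 0") auto
  define j where "j = \<lceil>real m * p - t\<rceil>"
  have j: "real m * p - t \<le> of_int j" "of_int j < real m * p - t + 1"
    unfolding j_def by linarith+
  define x where "x = (t + of_int j) / real m"
  have x: "real m * x = t + of_int j" using m by (simp add: x_def)
  have "real m * p \<le> real m * x" "real m * x \<le> real m * q"
    using j assms unfolding x by (simp_all add: algebra_simps)
  then show "x \<in> {p..q}" using m by simp
  have "2 * pi * real m * x = 2 * pi * t + 2 * pi * of_int j"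
    using x by (metis distrib_left mult.assoc)
  then show "trig_term a b m x = a m * cos (2 * pi * t) + b m * sin (2 * pi * t)"
    unfolding trig_term_def by (simp only: cos_add sin_add cos_int_2pin sin_int_2pin) simp
qed

text \<open>The sets \<open>T M\<close> are relatively open with empty intersection, so by Baire's
  theorem one of them is not dense. On some subinterval all terms from index \<open>M\<close> on are
  then at most \<epsilon>; once the subinterval spans a full period, the phases 0 and 1/4 isolate
  \<open>a m\<close> and \<open>b m\<close>.\<close>

lemma cantor_lebesgue:
  assumes "l < r" and lim: "\<And>x. x \<in> {l..r} \<Longrightarrow> (\<lambda>m. trig_term a b m x) \<longlonglongrightarrow> 0"
  shows "(\<lambda>m. \<bar>a m\<bar> + \<bar>b m\<bar>) \<longlonglongrightarrow> 0"
proof (rule LIMSEQ_I)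
  fix e :: real assume "e > 0"
  define \<epsilon> where "\<epsilon> = e / 3"
  have \<epsilon>: "\<epsilon> > 0" using \<open>e > 0\<close> by (simp add: \<epsilon>_def)
  define T where "T M = {x \<in> {l..r}. \<exists>m\<ge>M. \<bar>trig_term a b m x\<bar> > \<epsilon>}" for M :: nat
  have T_open: "openin (top_of_set {l..r}) (T M)" for M
  proof -
    have "open {x. \<bar>trig_term a b m x\<bar> > \<epsilon>}" for m
      using open_Collect_less[of "\<lambda>x. \<epsilon>" "\<lambda>x. \<bar>trig_term a b m x\<bar>"]
      by (simp add: continuous_intros)
    then have "open (\<Union>m\<in>{M..}. {x. \<bar>trig_term a b m x\<bar> > \<epsilon>})" by blast
    moreover have "T M = {l..r} \<inter> (\<Union>m\<in>{M..}. {x. \<bar>trig_term a b m x\<bar> > \<epsilon>})"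
      by (auto simp: T_def)
    ultimately show ?thesis by (metis openin_open)
  qed
  have "(\<Inter>M. T M) = {}"
  proof -
    have "x \<notin> T M" if "x \<in> {l..r}" "\<And>m. m \<ge> M \<Longrightarrow> \<bar>trig_term a b m x\<bar> < \<epsilon>" for x M
      using that by (force simp: T_def)
    moreover have "\<exists>M. \<forall>m\<ge>M. \<bar>trig_term a b m x\<bar> < \<epsilon>" if "x \<in> {l..r}" for x
      using LIMSEQ_D[OF lim[OF that] \<epsilon>] by simp
    ultimately show ?thesis by (fastforce simp: T_def)
  qed
  moreover have "{l..r} \<noteq> {}" using \<open>l < r\<close> by simp
  ultimately have "\<exists>M. \<not> {l..r} \<subseteq> closure (T M)"
    using Baire[of "{l..r}" "range T"] T_open by auto
  then obtain M y where y: "y \<in> {l..r}" "y \<notin> closure (T M)" by blast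
  then obtain d where d: "d > 0" "ball y d \<inter> T M = {}"
    by (auto simp: closure_approachable dist_commute disjoint_iff)
  obtain p q where pq: "p < q" "{p..q} \<subseteq> ball y d \<inter> {l..r}"
  proof
    show "max l (y - d / 2) < min r (y + d / 2)" using y d \<open>l < r\<close> by auto
    show "{max l (y - d / 2)..min r (y + d / 2)} \<subseteq> ball y d \<inter> {l..r}"
      using y d by (auto simp: dist_real_def)
  qed
  obtain N where N: "real N * (q - p) \<ge> 1"
    using pq(1) by (metis diff_gt_0_iff_gt less_imp_le reals_Archimedean3)
  show "\<exists>no. \<forall>n\<ge>no. norm (\<bar>a n\<bar> + \<bar>b n\<bar> - 0) < e"
  proof (intro exI allI impI)
    fix m assume m: "m \<ge> max M N"
    have mpq: "real m * (q - p) \<ge> 1"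
      using N m pq(1) by (smt (verit) mult_right_mono of_nat_le_iff max.bounded_iff)
    have "\<bar>trig_term a b m x\<bar> \<le> \<epsilon>" if "x \<in> {p..q}" for x
      using that pq d m by (force simp: T_def)
    then have "\<bar>a m * cos (2 * pi * t) + b m * sin (2 * pi * t)\<bar> \<le> \<epsilon>" for t
      using trig_term_phase[OF mpq, of a b t] by metis
    from this[of 0] this[of "1/4"] have "\<bar>a m\<bar> \<le> \<epsilon>" "\<bar>b m\<bar> \<le> \<epsilon>" by simp_all
    then show "norm (\<bar>a m\<bar> + \<bar>b m\<bar> - 0) < e" using \<open>e > 0\<close> by (simp add: \<epsilon>_def)
  qed
qed

section \<open>Riemann's second primitive of the series\<close>

text \<open>The summand with index 0 vanishes because \<open>x / 0 = 0\<close>.\<close>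

definition riemann_function :: "(nat \<Rightarrow> real) \<Rightarrow> (nat \<Rightarrow> real) \<Rightarrow> real \<Rightarrow> real" where
  "riemann_function a b x = a 0 * x\<^sup>2 / 2 - (\<Sum>m. trig_term a b m x / (2 * pi * real m)\<^sup>2)"

lemma trig_term_div_bound:
  assumes "\<And>m. \<bar>a m\<bar> + \<bar>b m\<bar> \<le> C"
  shows "norm (trig_term a b m x / (2 * pi * real m)\<^sup>2) \<le> C * (1 / real m ^ 2)"
proof (cases "m = 0")
  case False
  have "\<bar>trig_term a b m x\<bar> \<le> C" using abs_trig_term_le[of a b m x] assms[of m] by linarith
  moreover have "real m ^ 2 \<le> (2 * pi * real m)\<^sup>2"
    using pi_gt3 by (intro power_mono) (auto simp: mult_le_cancel_right1)
  ultimately have "\<bar>trig_term a b m x\<bar> / (2 * pi * real m)\<^sup>2 \<le> C / real m ^ 2"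
    using False by (intro frac_le) auto
  then show ?thesis by simp
qed simp

lemma summable_inverse_squares: "summable (\<lambda>m. C * (1 / real m ^ 2))"
  using inverse_power_summable[of 2, where ?'a = real] by (intro summable_mult) (simp add: inverse_eq_divide)

lemma continuous_on_riemann_function:
  assumes "\<And>m. \<bar>a m\<bar> + \<bar>b m\<bar> \<le> C"
  shows "continuous_on S (riemann_function a b)"
proof -
  have "uniform_limit S (\<lambda>n x. \<Sum>m<n. trig_term a b m x / (2 * pi * real m)\<^sup>2)
      (\<lambda>x. \<Sum>m. trig_term a b m x / (2 * pi * real m)\<^sup>2) sequentially"
    by (rule Weierstrass_m_test[OF trig_term_div_bound[OF assms] summable_inverse_squares])
  then have "continuous_on S (\<lambda>x. \<Sum>m. trig_term a b m x / (2 * pi * real m)\<^sup>2)"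
    by (rule uniform_limit_theorem[rotated])
      (auto simp: divide_inverse intro!: always_eventually continuous_intros)
  then show ?thesis unfolding riemann_function_def[abs_def] by (intro continuous_intros) auto
qed

text \<open>A second difference with step \<open>d\<close> multiplies the wave of frequency
  \<open>m\<close> by \<open>- (4 * (sin (pi * m * d))\<^sup>2)\<close>; the sign in front of the
  series and division by \<open>(2 * pi * m * d)\<^sup>2\<close> turn this factor into the
  kernel.\<close>

lemma riemann_function_second_difference:
  assumes C: "\<And>m. \<bar>a m\<bar> + \<bar>b m\<bar> \<le> C" and d: "d > 0"
  shows "(\<lambda>m. trig_term a b m x * riemann_kernel (real m * (pi * d))) sums
    ((riemann_function a b (x + d) + riemann_function a b (x - d) - 2 * riemann_function a b x) / d\<^sup>2)"
proof -
  define t where "t x m = trig_term a b m x / (2 * pi * real m)\<^sup>2" for x m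
  have t: "t x sums suminf (t x)" for x
    unfolding t_def using trig_term_div_bound[OF C] summable_inverse_squares
    by (intro summable_sums summable_comparison_test'[OF summable_inverse_squares]) auto
  \<comment> \<open>The extra \<open>a 0\<close> at index 0 comes from the quadratic part of
    \<open>riemann_function\<close>: the series contributes nothing there, yet the kernel is 1 at
    0.\<close>
  have "(\<lambda>m. (if m = 0 then a 0 else 0) - (t (x + d) m + t (x - d) m - 2 * t x m) / d\<^sup>2) sums
      (a 0 - (suminf (t (x + d)) + suminf (t (x - d)) - 2 * suminf (t x)) / d\<^sup>2)"
    by (intro sums_diff sums_divide sums_add sums_mult t sums_single[of 0 "\<lambda>_. a 0"])
  moreover have "(if m = 0 then a 0 else 0) - (t (x + d) m + t (x - d) m - 2 * t x m) / d\<^sup>2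
      = trig_term a b m x * riemann_kernel (real m * (pi * d))" for m
  proof (cases "m = 0")
    case True
    then show ?thesis by (simp add: t_def trig_term_def)
  next
    case False
    define \<theta> where "\<theta> = real m * (pi * d)"
    have \<theta>: "\<theta> > 0" using False d by (simp add: \<theta>_def)
    have arg: "2 * pi * real m * (x + d) = 2 * pi * real m * x + 2 * \<theta>"
      "2 * pi * real m * (x - d) = 2 * pi * real m * x - 2 * \<theta>"
      by (simp_all add: \<theta>_def algebra_simps)
    have "trig_term a b m (x + d) + trig_term a b m (x - d) - 2 * trig_term a b m x
        = trig_term a b m x * (2 * cos (2 * \<theta>) - 2)"
      unfolding trig_term_def arg by (simp add: cos_add cos_diff sin_add sin_diff algebra_simps)
    also have "2 * cos (2 * \<theta>) - 2 = - (4 * (sin \<theta>)\<^sup>2)"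
      by (simp add: cos_double_sin)
    finally have diff: "trig_term a b m (x + d) + trig_term a b m (x - d) - 2 * trig_term a b m x
        = trig_term a b m x * (- (4 * (sin \<theta>)\<^sup>2))" .
    have "t (x + d) m + t (x - d) m - 2 * t x m
        = (trig_term a b m (x + d) + trig_term a b m (x - d) - 2 * trig_term a b m x) / (2 * pi * real m)\<^sup>2"
      by (simp add: t_def diff_divide_distrib add_divide_distrib)
    then have "t (x + d) m + t (x - d) m - 2 * t x m
        = trig_term a b m x * (- (4 * (sin \<theta>)\<^sup>2)) / (2 * pi * real m)\<^sup>2"
      unfolding diff .
    also have "\<dots> / d\<^sup>2 = - (trig_term a b m x * riemann_kernel \<theta>)"
      using \<theta> False d by (simp add: riemann_kernel_def power_divide)
        (simp add: \<theta>_def power_mult_distrib field_simps)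
    finally show ?thesis using False by (simp add: \<theta>_def)
  qed
  moreover have "a 0 - (suminf (t (x + d)) + suminf (t (x - d)) - 2 * suminf (t x)) / d\<^sup>2
      = (riemann_function a b (x + d) + riemann_function a b (x - d) - 2 * riemann_function a b x) / d\<^sup>2"
    using d by (simp add: riemann_function_def t_def[abs_def] field_simps power2_eq_square)
  ultimately show ?thesis by simp
qed

text \<open>Riemann summation makes the second symmetric derivative of the primitive vanish
  throughout the interval. Schwarz's theorem then gives a second difference that is exactly 0 for
  the fixed step \<open>d\<close>, not only in the limit.\<close>

lemma riemann_kernel_sum_eq_0:
  assumes C: "\<And>m. \<bar>a m\<bar> + \<bar>b m\<bar> \<le> C" and d: "d > 0"
    and conv: "\<And>y. \<lbrakk>x - d < y; y < x + d\<rbrakk> \<Longrightarrow> (\<lambda>m. trig_term a b m y) sums 0"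
  shows "(\<lambda>m. trig_term a b m x * riemann_kernel (real m * (pi * d))) sums 0"
proof -
  let ?F = "riemann_function a b"
  have "?F ((x - d + (x + d)) / 2) = (?F (x - d) + ?F (x + d)) / 2"
  proof (rule schwarz_affine[OF continuous_on_riemann_function[OF C]])
    fix y assume y: "x - d < y" "y < x + d"
    have lim: "((\<lambda>h. \<Sum>m. trig_term a b m y * riemann_kernel (real m * h)) \<longlongrightarrow> 0) (at_right 0)"
    proof (rule riemann_summation[OF conv[OF y]])
      fix h :: real assume "h > 0"
      then show "summable (\<lambda>m. trig_term a b m y * riemann_kernel (real m * h))"
        using riemann_function_second_difference[of a b C "h / pi" y, OF C] by (simp add: sums_iff)
    qed
    \<comment> \<open>A step \<open>h\<close> of the second difference corresponds to the kernel
      scale \<open>pi * h\<close>.\<close>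
    have "filterlim (\<lambda>h. pi * h) (at_right 0) (at_right (0::real))"
      by (intro filterlim_at_withinI tendsto_eq_intros)
         (auto simp: eventually_at_filter)
    from filterlim_compose[OF lim this]
    have "((\<lambda>h. \<Sum>m. trig_term a b m y * riemann_kernel (real m * (pi * h))) \<longlongrightarrow> 0) (at_right 0)" .
    then show "((\<lambda>h. (?F (y + h) + ?F (y - h) - 2 * ?F y) / h\<^sup>2) \<longlongrightarrow> 0) (at_right 0)"
    proof (rule Lim_transform_eventually)
      show "\<forall>\<^sub>F h in at_right 0. (\<Sum>m. trig_term a b m y * riemann_kernel (real m * (pi * h)))
          = (?F (y + h) + ?F (y - h) - 2 * ?F y) / h\<^sup>2"
        using riemann_function_second_difference[of a b C _ y, OF C]
        by (auto simp: eventually_at_filter sums_iff)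
    qed
  qed (use d in simp)
  then have "?F (x + d) + ?F (x - d) - 2 * ?F x = 0" by simp
  then show ?thesis
    using riemann_function_second_difference[of a b C d x, OF C d] by (simp only: div_0)
qed

section \<open>Isolating one frequency by averaging over midpoints\<close>

text \<open>The sample points are the minima of \<open>cos (2 * pi * n * x)\<close> in the unit
  interval, that is, the centres of the gaps left when this cosine is required to be
  nonnegative.\<close>

definition midpoint_average :: "nat \<Rightarrow> int \<Rightarrow> complex" where
  "midpoint_average n q = (\<Sum>j<n. cis (2 * pi * of_int q * ((real j + 1/2) / real n))) / of_nat n"

lemma midpoint_average_0: "n > 0 \<Longrightarrow> midpoint_average n 0 = 1"
  by (simp add: midpoint_average_def)

lemma norm_midpoint_average_le: "norm (midpoint_average n q) \<le> 1"
proof -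
  have "norm (\<Sum>j<n. cis (2 * pi * of_int q * ((real j + 1/2) / real n))) \<le> (\<Sum>j<n. 1)"
    by (rule sum_norm_le) simp
  then show ?thesis
    by (cases "n = 0") (simp_all add: midpoint_average_def norm_divide)
qed

text \<open>Up to a phase factor this is a full geometric sum of an \<open>n\<close>-th root of
  unity other than 1.\<close>

lemma midpoint_average_eq_0:
  assumes "n > 0" "\<not> int n dvd q"
  shows "midpoint_average n q = 0"
proof -
  define z where "z = cis (2 * pi * of_int q / real n)"
  have "z \<noteq> 1"
  proof
    assume "z = 1"
    then have "cos (2 * pi * of_int q / real n) = 1"
      by (metis cis.sel(1) one_complex.sel(1) z_def)
    then obtain k :: int where "2 * pi * of_int q / real n = of_int k * 2 * pi"
      using cos_one_2pi_int by blast
    then have "real_of_int q = of_int k * real n" using assms(1) by (simp add: field_simps)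
    then have "q = k * int n" by (metis of_int_eq_iff of_int_mult of_int_of_nat_eq)
    then show False using assms(2) by simp
  qed
  have "z ^ n = cis (2 * pi * of_int q)"
    using assms(1) by (simp only: z_def Complex.DeMoivre) simp
  then have "z ^ n = 1" by (simp add: complex_eq_iff)
  have "cis (2 * pi * of_int q * ((real j + 1/2) / real n)) = cis (pi * of_int q / real n) * z ^ j" for j
    using assms(1) unfolding z_def Complex.DeMoivre cis_mult by (intro arg_cong[of _ _ cis]) (simp add: field_simps)
  then have "midpoint_average n q = cis (pi * of_int q / real n) * (\<Sum>j<n. z ^ j) / of_nat n"
    by (simp add: midpoint_average_def sum_distrib_left)
  then show ?thesis
    using \<open>z \<noteq> 1\<close> \<open>z ^ n = 1\<close> by (simp add: geometric_sum)
qed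

text \<open>Splits the real wave into its frequencies \<open>m\<close> and \<open>-m\<close>, both
  shifted by \<open>-p\<close>, as \<open>midpoint_average\<close> requires.\<close>

lemma trig_term_cis:
  "complex_of_real (trig_term a b m x) * cis (- (2 * pi * real p * x)) =
     Complex (a m / 2) (- b m / 2) * cis (2 * pi * of_int (int m - int p) * x) +
     Complex (a m / 2) (b m / 2) * cis (2 * pi * of_int (- int m - int p) * x)"
proof -
  define s where "s = 2 * pi * real m * x"
  define t where "t = 2 * pi * real p * x"
  have "2 * pi * of_int (int m - int p) * x = s - t" "2 * pi * of_int (- int m - int p) * x = - s - t"
    unfolding s_def t_def by (simp_all add: algebra_simps)
  then show ?thesis
    unfolding trig_term_def s_def[symmetric] t_def[symmetric]
    by (simp only:) (simp add: complex_eq_iff cos_diff sin_diff cos_add sin_add algebra_simps)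
qed

text \<open>The induction carries the sharper bound \<open>2 - 1 / N\<close>, so that the increments
  telescope.\<close>

lemma sum_inverse_squares_le: "(\<Sum>l\<in>{1..N}. 1 / (real l)\<^sup>2) \<le> 2"
proof -
  have "(\<Sum>l\<in>{1..Suc N}. 1 / (real l)\<^sup>2) \<le> 2 - 1 / real (Suc N)" for N
  proof (induction N)
    case (Suc N)
    have "1 / (real (Suc (Suc N)))\<^sup>2 \<le> 1 / real (Suc N) - 1 / real (Suc (Suc N))"
    proof -
      have "1 / (real (Suc (Suc N)))\<^sup>2 \<le> 1 / (real (Suc N) * real (Suc (Suc N)))"
        by (intro divide_left_mono) (auto simp: power2_eq_square)
      also have "\<dots> = 1 / real (Suc N) - 1 / real (Suc (Suc N))"
        by (simp add: field_simps)
      finally show ?thesis .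
    qed
    then show ?case using Suc by (simp del: of_nat_Suc)
  qed simp
  then have "(\<Sum>l\<in>{1..Suc N}. 1 / (real l)\<^sup>2) \<le> 2" for N
    by (smt (verit) divide_nonneg_nonneg of_nat_0_le_iff)
  then show ?thesis by (cases N) auto
qed

text \<open>\<open>R m\<close> is the midpoint average of the \<open>m\<close>-th term against the
  character of frequency \<open>-p\<close>. It vanishes unless \<open>m\<close> is congruent to
  \<open>p\<close> or \<open>-p\<close> modulo \<open>n\<close>. Apart from \<open>p\<close> itself
  such \<open>m\<close> are at least \<open>n - p\<close>, where coefficients are at most
  \<epsilon>, and the kernel decays quadratically along them. As the weighted \<open>R m\<close> sum
  to 0, the term at \<open>p\<close> is as small as all the others together.\<close>

lemma fourier_coefficient_bound:
  assumes n: "2 * p < n" and small: "\<And>m. m \<ge> n - p \<Longrightarrow> \<bar>a m\<bar> + \<bar>b m\<bar> \<le> \<epsilon>"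
    and sums: "\<And>j. j < n \<Longrightarrow>
      (\<lambda>m. trig_term a b m ((real j + 1/2) / real n) * riemann_kernel (real m * (pi * (1 / (8 * real n))))) sums 0"
  shows "norm (Complex (a p / 2) (if p = 0 then 0 else - b p / 2)) * riemann_kernel (real p * (pi * (1 / (8 * real n)))) \<le> 128 * \<epsilon>"
proof -
  define \<kappa> where "\<kappa> m = riemann_kernel (real m * (pi * (1 / (8 * real n))))" for m
  define x where "x j = (real j + 1/2) / real n" for j
  define R where "R m = (\<Sum>j<n. complex_of_real (trig_term a b m (x j)) * cis (- (2 * pi * real p * x j))) / of_nat n" for m
  have n0: "n > 0" using n by simp
  have \<epsilon>: "\<epsilon> \<ge> 0" using small[of n] by (auto intro: order_trans[rotated])
  have R: "R m = Complex (a m / 2) (- b m / 2) * midpoint_average n (int m - int p) +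
      Complex (a m / 2) (b m / 2) * midpoint_average n (- int m - int p)" for m
    by (simp add: R_def trig_term_cis midpoint_average_def x_def sum.distrib sum_distrib_left add_divide_distrib)
  have R_bound: "norm (R m) \<le> \<bar>a m\<bar> + \<bar>b m\<bar>" for m
  proof -
    have c: "norm (Complex (a m / 2) (s * b m / 2)) \<le> (\<bar>a m\<bar> + \<bar>b m\<bar>) / 2" if "s = 1 \<or> s = -1" for s
      using cmod_le[of "Complex (a m / 2) (s * b m / 2)"] that by auto
    have "norm (R m) \<le> (\<bar>a m\<bar> + \<bar>b m\<bar>) / 2 * 1 + (\<bar>a m\<bar> + \<bar>b m\<bar>) / 2 * 1"
      unfolding R using c[of 1] c[of "-1"]
      by (intro order_trans[OF norm_triangle_ineq] add_mono; unfold norm_mult)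
        (intro mult_mono norm_midpoint_average_le; simp)+
    then show ?thesis by simp
  qed
  have R_0: "R m = 0" if "\<not> int n dvd int m - int p" "\<not> int n dvd int m + int p" for m
  proof -
    have "\<not> int n dvd - int m - int p"
      using that(2) by (metis dvd_minus_iff minus_add_distrib uminus_add_conv_diff add.commute)
    then show ?thesis using that n0 by (simp add: R midpoint_average_eq_0)
  qed
  \<comment> \<open>For \<open>p > 0\<close> the condition \<open>2 * p < n\<close> keeps frequency
    \<open>-p\<close> from aliasing to \<open>p\<close>. For \<open>p = 0\<close> both halves sit at
    frequency 0: the parts with \<open>b\<close> cancel and \<open>a 0\<close> appears
    undivided.\<close>
  have R_p: "norm (Complex (a p / 2) (if p = 0 then 0 else - b p / 2)) \<le> norm (R p)"
  proof (cases "p = 0")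
    case True
    then have "R p = complex_of_real (a p)"
      using n0 by (simp add: R midpoint_average_0 complex_eq_iff)
    then show ?thesis using True by (simp add: cmod_def)
  next
    case False
    have "\<not> int n dvd - int p - int p"
    proof
      assume "int n dvd - int p - int p"
      then have "int n dvd int (2 * p)" by (metis dvd_minus_iff mult_2 minus_add_distrib of_nat_add uminus_add_conv_diff add.commute)
      then show False using n False by (auto dest: zdvd_imp_le)
    qed
    then show ?thesis using False n0 by (simp add: R midpoint_average_0 midpoint_average_eq_0)
  qed
  have R_sums: "(\<lambda>m. R m * of_real (\<kappa> m)) sums 0"
  proof -
    have "(\<lambda>m. \<Sum>j<n. cis (- (2 * pi * real p * x j)) * of_real (trig_term a b m (x j) * \<kappa> m)) sums
        (\<Sum>j<n. cis (- (2 * pi * real p * x j)) * of_real 0)"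
      unfolding \<kappa>_def by (intro sums_sum sums_mult sums_of_real) (use sums in \<open>auto simp: x_def\<close>)
    then have "(\<lambda>m. (\<Sum>j<n. cis (- (2 * pi * real p * x j)) * of_real (trig_term a b m (x j) * \<kappa> m)) / of_nat n) sums (0 / of_nat n)"
      by (intro sums_divide) simp
    then show ?thesis
      by (simp add: R_def sum_distrib_left sum_distrib_right sum_divide_distrib mult_ac)
  qed
  \<comment> \<open>From \<open>2 * p < n\<close> follows \<open>m \<ge> n * l / 2\<close>, so the
    kernel argument is at least \<open>3 * l / 16\<close>; 32 rounds up 256/9.\<close>
  have term_bound: "norm (R m * of_real (\<kappa> m)) \<le> \<epsilon> * (32 * (1 / (real l)\<^sup>2))"
    if l: "l \<ge> 1" and m: "m = n * l + p \<or> m = n * l - p" for m l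
  proof -
    have nl: "n \<le> n * l" using mult_le_mono2[OF l, of n] by simp
    then have "m \<ge> n - p" using m by linarith
    then have 1: "norm (R m) \<le> \<epsilon>" using R_bound small order_trans by blast
    have "real (n * l) \<le> real (2 * m)"
      using m n nl by (intro of_nat_mono) linarith
    then have m2: "real n * real l / 2 \<le> real m" by simp
    have "3 / 16 * real l = (real n * real l / 2) * (3 * (1 / (8 * real n)))"
      using n0 by simp
    also have "\<dots> \<le> real m * (pi * (1 / (8 * real n)))"
      using m2 pi_gt3 by (intro mult_mono) auto
    finally have t: "3 / 16 * real l \<le> real m * (pi * (1 / (8 * real n)))" .
    have "0 < 3 / 16 * real l" using l by simp
    then have "\<kappa> m \<le> 1 / (3 / 16 * real l)\<^sup>2"
      unfolding \<kappa>_def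
      using riemann_kernel_le_inverse_square[of "real m * (pi * (1 / (8 * real n)))"] t
      by (smt (verit) frac_le power_mono zero_less_power)
    also have "\<dots> \<le> 32 * (1 / (real l)\<^sup>2)"
      using l by (simp add: power_mult_distrib power_divide field_simps)
    finally have "\<kappa> m \<le> 32 * (1 / (real l)\<^sup>2)" .
    moreover have "\<kappa> m \<ge> 0" by (simp add: \<kappa>_def riemann_kernel_nonneg)
    ultimately show ?thesis
      unfolding norm_mult norm_of_real using 1 \<epsilon> by (intro mult_mono) auto
  qed
  have partial: "norm (\<Sum>m\<in>{..<N} - {p}. R m * of_real (\<kappa> m)) \<le> 128 * \<epsilon>" for N
  proof -
    define g where "g m = norm (R m * of_real (\<kappa> m))" for m
    \<comment> \<open>Every index below \<open>N\<close> congruent to \<open>p\<close> or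
      \<open>-p\<close> modulo \<open>n\<close>, other than \<open>p\<close>, lies in one of these
      two families; each has \<open>l \<ge> 1\<close>, and \<open>l \<le> N\<close> is
      enough.\<close>
    define A where "A = (\<lambda>l. n * l + p) ` {1..N}"
    define A' where "A' = (\<lambda>l. n * l - p) ` {1..N}"
    have fin: "finite A" "finite A'" by (simp_all add: A_def A'_def)
    have zero: "g m = 0" if m: "m \<in> {..<N} - {p} - (A \<union> A')" for m
    proof (rule ccontr)
      assume "g m \<noteq> 0"
      then have "R m \<noteq> 0" by (auto simp: g_def)
      then consider "int n dvd int m - int p" | "int n dvd int m + int p" using R_0 by blast
      then show False
      proof cases
        case 1
        then obtain k where k: "int m - int p = int n * k" by (auto simp: dvd_def)
        have "k \<noteq> 0" using k m by auto
        moreover have "\<not> k \<le> -1"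
        proof
          assume "k \<le> -1"
          then have "int n * k \<le> int n * (-1)" by (intro mult_left_mono) auto
          then show False using k n by simp
        qed
        ultimately have "k \<ge> 1" by simp
        then obtain l where l: "k = int l" "l \<ge> 1" by (metis nat_0_le nat_int of_nat_1 of_nat_le_iff order_trans zero_le_one)
        have "m = n * l + p" using k l by (metis add.commute diff_eq_eq of_nat_add of_nat_eq_iff of_nat_mult)
        moreover have "l \<le> n * l" using n0 by simp
        moreover have "m < N" using m by blast
        ultimately have "l \<in> {1..N}" using l(2) unfolding atLeastAtMost_iff by linarith
        then have "m \<in> A" unfolding A_def using \<open>m = n * l + p\<close> by blast
        then show False using m by blast
      next
        case 2
        then have "n dvd m + p" by (metis of_nat_add of_nat_dvd_iff)
        then obtain l where l: "m + p = n * l" by (auto simp: dvd_def)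
        then have "l \<noteq> 0" using m n by (metis Diff_iff add_is_0 insertI1 mult_0_right)
        moreover have "l \<le> N"
        proof (rule ccontr)
          assume "\<not> l \<le> N"
          then have "n * (N + 1) \<le> n * l" by (intro mult_le_mono2) simp
          then have "n * N + n \<le> m + p" using l by simp
          moreover have "N \<le> n * N" using n0 by simp
          moreover have "m < N" using m by blast
          ultimately show False using n by linarith
        qed
        ultimately have "l \<in> {1..N}" by simp
        moreover have "m = n * l - p" using l by simp
        ultimately have "m \<in> A'" unfolding A'_def by blast
        then show False using m by blast
      qed
    qed
    \<comment> \<open>Each family costs 32 from \<open>term_bound\<close> times 2 from the inverse
      squares; two families make 128.\<close>
    have *: "(\<Sum>m\<in>f ` {1..N}. g m) \<le> 64 * \<epsilon>" if f: "\<And>l. f l = n * l + p \<or> f l = n * l - p" for f :: "nat \<Rightarrow> nat"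
    proof -
      have "(\<Sum>m\<in>f ` {1..N}. g m) \<le> (\<Sum>l\<in>{1..N}. g (f l))"
        using sum_image_le[of "{1..N}" g f] by (simp add: g_def)
      also have "\<dots> \<le> (\<Sum>l\<in>{1..N}. \<epsilon> * (32 * (1 / (real l)\<^sup>2)))"
        unfolding g_def using f by (intro sum_mono term_bound) auto
      also have "\<dots> = \<epsilon> * 32 * (\<Sum>l\<in>{1..N}. 1 / (real l)\<^sup>2)"
        by (simp add: sum_distrib_left mult.assoc)
      also have "\<dots> \<le> \<epsilon> * 32 * 2" using \<epsilon> sum_inverse_squares_le by (intro mult_left_mono) auto
      finally show ?thesis by simp
    qed
    have "norm (\<Sum>m\<in>{..<N} - {p}. R m * of_real (\<kappa> m)) \<le> sum g ({..<N} - {p})"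
      unfolding g_def by (rule norm_sum)
    also have "\<dots> = sum g (({..<N} - {p}) \<inter> (A \<union> A'))"
      by (intro sum.mono_neutral_right ballI zero) auto
    also have "\<dots> \<le> sum g (A \<union> A')"
      using fin by (intro sum_mono2) (auto simp: g_def)
    also have "\<dots> \<le> sum g A + sum g A'"
      using fin by (simp add: sum_Un g_def sum_nonneg)
    also have "\<dots> \<le> 64 * \<epsilon> + 64 * \<epsilon>" unfolding A_def A'_def by (intro add_mono *) auto
    finally show ?thesis by simp
  qed
  have "(\<lambda>N. norm ((\<Sum>m<N. R m * of_real (\<kappa> m)) - R p * of_real (\<kappa> p))) \<longlonglongrightarrow> norm (0 - R p * of_real (\<kappa> p))"
    using R_sums unfolding sums_def by (intro tendsto_intros)
  then have "norm (0 - R p * of_real (\<kappa> p)) \<le> 128 * \<epsilon>"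
  proof (rule LIMSEQ_le_const2)
    show "\<exists>M. \<forall>N\<ge>M. norm ((\<Sum>m<N. R m * of_real (\<kappa> m)) - R p * of_real (\<kappa> p)) \<le> 128 * \<epsilon>"
    proof (intro exI allI impI)
      fix N assume "N \<ge> Suc p"
      then have "(\<Sum>m<N. R m * of_real (\<kappa> m)) - R p * of_real (\<kappa> p) = (\<Sum>m\<in>{..<N} - {p}. R m * of_real (\<kappa> m))"
        by (simp add: sum_diff1)
      then show "norm ((\<Sum>m<N. R m * of_real (\<kappa> m)) - R p * of_real (\<kappa> p)) \<le> 128 * \<epsilon>"
        using partial by simp
    qed
  qed
  then have "norm (R p) * \<kappa> p \<le> 128 * \<epsilon>"
    using riemann_kernel_nonneg by (simp add: norm_mult \<kappa>_def)
  moreover have "norm (Complex (a p / 2) (if p = 0 then 0 else - b p / 2)) * \<kappa> p \<le> norm (R p) * \<kappa> p"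
    using R_p riemann_kernel_nonneg by (intro mult_right_mono) (auto simp: \<kappa>_def)
  ultimately show ?thesis by (simp add: \<kappa>_def)
qed

text \<open>At the midpoint \<open>n * x\<close> is half an odd integer, so the cosine is -1 there,
  and it stays negative for less than a quarter period to either side.\<close>

lemma cos_neg_near_midpoint:
  assumes "n > 0" "\<bar>x - (real j + 1/2) / real n\<bar> < 1 / (4 * real n)"
  shows "cos (2 * pi * real n * x) < 0"
proof -
  define y where "y = 2 * pi * (real n * x - (real j + 1/2))"
  have "real n * x - (real j + 1/2) = real n * (x - (real j + 1/2) / real n)"
    using assms(1) by (simp add: right_diff_distrib)
  then have "\<bar>real n * x - (real j + 1/2)\<bar> = real n * \<bar>x - (real j + 1/2) / real n\<bar>"
    by (simp add: abs_mult)
  also have "\<dots> < 1 / 4" using assms by (simp add: field_simps)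
  finally have "\<bar>y\<bar> < pi / 2" by (simp add: y_def abs_mult)
  then have "cos y > 0" by (intro cos_gt_zero_pi) auto
  moreover have "2 * pi * real n * x = y + pi + 2 * pi * real j" by (simp add: y_def algebra_simps)
  moreover have "cos (y + pi + 2 * pi * real j) = - cos y"
    using cos_int_2pin[of "int j"] sin_int_2pin[of "int j"] by (simp add: cos_add)
  ultimately show ?thesis by simp
qed

text \<open>For each admissible \<open>n\<close> the series converges to 0 in gaps around all
  \<open>n\<close> midpoints. Cantor's theorem in one gap makes the coefficients null; then
  \<open>fourier_coefficient_bound\<close> along arbitrarily large admissible \<open>n\<close>
  forces each coefficient to be 0.\<close>

lemma set_of_uniqueness_if_cos_nonneg:
  assumes "E \<subseteq> {0..1}" and freq: "\<And>B::nat. \<exists>n>B. E \<subseteq> {x. cos (2 * pi * real n * x) \<ge> 0}"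
  shows "set_of_uniqueness E"
  unfolding set_of_uniqueness_def
proof (intro conjI allI impI)
  fix a b :: "nat \<Rightarrow> real"
  assume "\<forall>x\<in>{0..1} - E. (\<lambda>n. a n * cos (2 * pi * real n * x) + b n * sin (2 * pi * real n * x)) sums 0"
  then have conv: "(\<lambda>m. trig_term a b m x) sums 0" if "x \<in> {0..1} - E" for x
    using that by (simp add: trig_term_def)
  \<comment> \<open>The gap of radius \<open>1 / (4 * n)\<close> around a midpoint stays inside the
    unit interval and misses \<open>E\<close>.\<close>
  have conv': "(\<lambda>m. trig_term a b m x) sums 0"
    if "E \<subseteq> {x. cos (2 * pi * real n * x) \<ge> 0}" "j < n" "\<bar>x - (real j + 1/2) / real n\<bar> < 1 / (4 * real n)" for n j x
  proof (rule conv)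
    have n: "real n > 0" using that by simp
    have "real j + 1 \<le> real n" using that by simp
    then have "(real j + 1/2) / real n + 1 / (4 * real n) \<le> 1"
      using n by (simp add: field_simps)
    moreover have "(real j + 1/2) / real n - 1 / (4 * real n) \<ge> 0"
      using n by (simp add: field_simps)
    moreover have "x \<notin> E" using cos_neg_near_midpoint[of n x j] that by force
    ultimately show "x \<in> {0..1} - E" using that(3) by (auto simp: abs_less_iff)
  qed
  \<comment> \<open>The gap around the first midpoint suffices; halving its radius gives a closed
    interval inside it.\<close>
  have lim: "(\<lambda>m. \<bar>a m\<bar> + \<bar>b m\<bar>) \<longlonglongrightarrow> 0"
  proof -
    obtain n where n: "n > 0" "E \<subseteq> {x. cos (2 * pi * real n * x) \<ge> 0}" using freq by blast
    show ?thesis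
    proof (rule cantor_lebesgue)
      have "1 / (8 * real n) > 0" using n by simp
      then show "(1/2) / real n - 1 / (8 * real n) < (1/2) / real n + 1 / (8 * real n)" by linarith
    next
      fix x assume x: "x \<in> {(1/2) / real n - 1 / (8 * real n)..(1/2) / real n + 1 / (8 * real n)}"
      have "1 / (8 * real n) < 1 / (4 * real n)" using n by (simp add: field_simps)
      then have "\<bar>x - (real 0 + 1/2) / real n\<bar> < 1 / (4 * real n)" using x by auto
      then show "(\<lambda>m. trig_term a b m x) \<longlonglongrightarrow> 0"
        using conv'[of n 0 x] n by (auto intro: summable_LIMSEQ_zero sums_summable)
    qed
  qed
  then obtain C where C: "\<And>m. \<bar>a m\<bar> + \<bar>b m\<bar> \<le> C"
    using Bseq_def[of "\<lambda>m. \<bar>a m\<bar> + \<bar>b m\<bar>"] convergent_imp_Bseq[of "\<lambda>m. \<bar>a m\<bar> + \<bar>b m\<bar>"]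
    by (auto simp: convergent_def)
  have coeff: "Complex (a p / 2) (if p = 0 then 0 else - b p / 2) = 0" for p
  proof -
    let ?c = "norm (Complex (a p / 2) (if p = 0 then 0 else - b p / 2))"
    have "?c \<le> 256 * \<epsilon>" if \<epsilon>: "\<epsilon> > 0" for \<epsilon>
    proof -
      obtain M where M: "\<And>m. m \<ge> M \<Longrightarrow> \<bar>a m\<bar> + \<bar>b m\<bar> \<le> \<epsilon>"
        using LIMSEQ_D[OF lim \<epsilon>] by force
      have "(\<lambda>n. real p * (pi * (1 / (8 * real n)))) \<longlonglongrightarrow> 0"
        using lim_const_over_n[of "real p * pi / 8"] by simp
      then have "(\<lambda>n. riemann_kernel (real p * (pi * (1 / (8 * real n))))) \<longlonglongrightarrow> riemann_kernel 0"
        by (rule isCont_tendsto_compose[OF isCont_riemann_kernel])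
      then have "\<forall>\<^sub>F n in sequentially. riemann_kernel (real p * (pi * (1 / (8 * real n)))) > 1 / 2"
        by (rule order_tendstoD) simp
      then obtain N where N: "\<And>n. n \<ge> N \<Longrightarrow> riemann_kernel (real p * (pi * (1 / (8 * real n)))) > 1 / 2"
        by (auto simp: eventually_sequentially)
      \<comment> \<open>The three thresholds give \<open>n - p \<ge> M\<close>,
        \<open>2 * p < n\<close>, and a kernel weight above 1/2 at \<open>p\<close>; the last
        doubles 128 to 256.\<close>
      obtain n where n: "n > M + 2 * p + N" "E \<subseteq> {x. cos (2 * pi * real n * x) \<ge> 0}" using freq by blast
      have "?c * riemann_kernel (real p * (pi * (1 / (8 * real n)))) \<le> 128 * \<epsilon>"
      proof (rule fourier_coefficient_bound)
        fix j assume j: "j < n"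
        show "(\<lambda>m. trig_term a b m ((real j + 1/2) / real n) *
            riemann_kernel (real m * (pi * (1 / (8 * real n))))) sums 0"
        proof (rule riemann_kernel_sum_eq_0[OF C])
          show "1 / (8 * real n) > 0" using n by simp
          fix y assume "(real j + 1/2) / real n - 1 / (8 * real n) < y" "y < (real j + 1/2) / real n + 1 / (8 * real n)"
          moreover have "1 / (8 * real n) < 1 / (4 * real n)" using n by (simp add: field_simps)
          ultimately show "(\<lambda>m. trig_term a b m y) sums 0"
            using conv'[OF n(2) j, of y] by auto
        qed
      qed (use n M in auto)
      moreover have "?c * (1 / 2) \<le> ?c * riemann_kernel (real p * (pi * (1 / (8 * real n))))"
        using N[of n] n by (intro mult_left_mono) auto
      ultimately show ?thesis by simp
    qed
    from this[of "e / 256" for e] have "?c \<le> 0 + e" if "e > 0" for e using that by simp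
    then have "?c \<le> 0" by (rule field_le_epsilon)
    then show ?thesis by simp
  qed
  show "a n = 0" for n using coeff[of n] by (simp add: complex_eq_iff)
  show "b n = 0" if "n \<ge> 1" for n using coeff[of n] that by (simp add: complex_eq_iff)
qed fact


section \<open>Almost every number is absolutely normal\<close>

lemma set_integrable_bounded_borel:
  fixes g :: "real \<Rightarrow> real"
  assumes "g \<in> borel_measurable borel" "\<And>x. \<bar>g x\<bar> \<le> C"
  shows "set_integrable lborel {u..v} g"
proof (rule set_integrable_bound)
  show "set_integrable lborel {u..v} (\<lambda>x. C)"
    unfolding set_integrable_def by (rule borel_integrable_compact) auto
  show "set_borel_measurable lborel {u..v} g"
    unfolding set_borel_measurable_def using assms(1) by measurable
  show "AE x in lborel. x \<in> {u..v} \<longrightarrow> norm (g x) \<le> norm C"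
    using assms(2) by (auto intro!: AE_I2 order_trans[OF _ abs_ge_self])
qed

lemma integrable_on_bounded_borel:
  fixes g :: "real \<Rightarrow> real"
  assumes "g \<in> borel_measurable borel" "\<And>x. \<bar>g x\<bar> \<le> C"
  shows "g integrable_on {u..v}"
  by (rule set_borel_integral_eq_integral(1)[OF set_integrable_bounded_borel[OF assms]])

lemma integral_le_bound_real:
  fixes g :: "real \<Rightarrow> real"
  assumes "g integrable_on {u..v}" "\<And>x. \<bar>g x\<bar> \<le> C" "u \<le> v"
  shows "\<bar>integral {u..v} g\<bar> \<le> C * (v - u)"
proof -
  have "C \<ge> 0" using order_trans[OF abs_ge_zero assms(2)] .
  then show ?thesis
    using has_integral_bound_real[OF _ finite.emptyI integrable_integral[OF assms(1)], of C] assms(2,3) by simp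
qed

lemma periodic_add_nat:
  assumes "\<And>x::real. g (x + 1) = g x"
  shows "g (real m + x) = g x"
proof (induction m)
  case (Suc m)
  have "g (real (Suc m) + x) = g ((real m + x) + 1)" by (simp add: algebra_simps)
  then show ?case using assms Suc by simp
qed simp

lemma integral_periodic_nat:
  fixes g :: "real \<Rightarrow> real"
  assumes int: "\<And>u v. g integrable_on {u..v}" and per: "\<And>x. g (x + 1) = g x"
  shows "integral {0..real m} g = real m * integral {0..1} g"
proof (induction m)
  case (Suc m)
  have "g \<circ> (+) (real m) = g" using periodic_add_nat[of g, OF per] by (auto simp: fun_eq_iff)
  then have "integral {0..1} g = integral {real m..real (Suc m)} g"
    using integral_shift_Icc_real[of 0 1 g "real m"] by (simp add: add.commute)
  moreover have "integral {0..real m} g + integral {real m..real (Suc m)} g = integral {0..real (Suc m)} g"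
    by (rule Henstock_Kurzweil_Integration.integral_combine) (use int in auto)
  ultimately show ?case using Suc by (simp add: algebra_simps)
qed simp

lemma integral_stretch_nat:
  fixes g :: "real \<Rightarrow> real"
  assumes int: "\<And>u v. g integrable_on {u..v}" and "n > 0"
  shows "integral {u..v} (\<lambda>x. g (real n * x)) = integral {real n * u..real n * v} g / real n"
proof -
  have "((\<lambda>x. g (real n * x)) has_integral (1 / \<bar>real n\<bar>) *\<^sub>R integral {real n * u..real n * v} g)
      ((\<lambda>x. x / real n) ` {real n * u..real n * v})"
    using \<open>n > 0\<close> by (intro has_integral_stretch_real integrable_integral int) auto
  also have "(\<lambda>x. x / real n) ` {real n * u..real n * v} = {u..v}"
    using \<open>n > 0\<close> by (auto simp: image_iff field_simps intro!: bexI[of _ "real n * _"])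
  finally show ?thesis by (simp add: integral_unique)
qed

lemma integral_periodic_stretch:
  fixes g :: "real \<Rightarrow> real"
  assumes int: "\<And>u v. g integrable_on {u..v}" and per: "\<And>x. g (x + 1) = g x" and "n > 0"
  shows "integral {0..1} (\<lambda>x. g (real n * x)) = integral {0..1} g"
  using integral_stretch_nat[of g n 0 1, OF int \<open>n > 0\<close>] integral_periodic_nat[of g n, OF int per] \<open>n > 0\<close>
  by simp

text \<open>Full periods integrate to 0, so integrals from 0 are at most 1 in size and those over
  any interval at most 2. Stretching by \<open>n\<close> divides by \<open>n\<close>.\<close>

lemma integral_mean_zero_stretch_bound:
  fixes g :: "real \<Rightarrow> real"
  assumes int: "\<And>u v. g integrable_on {u..v}" and per: "\<And>x. g (x + 1) = g x"
    and mean: "integral {0..1} g = 0" and bound: "\<And>x. \<bar>g x\<bar> \<le> 1"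
    and "n > 0" "0 \<le> u" "u \<le> v"
  shows "\<bar>integral {u..v} (\<lambda>x. g (real n * x))\<bar> \<le> 2 / real n"
proof -
  have initial: "\<bar>integral {0..t} g\<bar> \<le> 1" if "t \<ge> 0" for t
  proof -
    define m where "m = nat \<lfloor>t\<rfloor>"
    have m: "real m \<le> t" "t \<le> real m + 1" using that unfolding m_def by linarith+
    have "integral {0..real m} g + integral {real m..t} g = integral {0..t} g"
      by (rule Henstock_Kurzweil_Integration.integral_combine) (use int m in auto)
    then have "integral {0..t} g = integral {real m..t} g"
      using integral_periodic_nat[of g m, OF int per] mean by simp
    moreover have "\<bar>integral {real m..t} g\<bar> \<le> 1 * (t - real m)"
      using int bound m by (intro integral_le_bound_real) auto
    ultimately show ?thesis using m by simp
  qed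
  have "integral {0..real n * u} g + integral {real n * u..real n * v} g = integral {0..real n * v} g"
    by (rule Henstock_Kurzweil_Integration.integral_combine) (use int assms in \<open>auto intro: mult_left_mono\<close>)
  then have "\<bar>integral {real n * u..real n * v} g\<bar> \<le> 2"
    using initial[of "real n * u"] initial[of "real n * v"] assms by (simp add: abs_le_iff)
  then show ?thesis
    using integral_stretch_nat[of g n u v, OF int \<open>n > 0\<close>] \<open>n > 0\<close>
    by (simp add: abs_divide divide_right_mono)
qed

section \<open>A strong law of large numbers from a variance bound\<close>

text \<open>Along the squares \<open>N = m\<^sup>2\<close> the averages have second moments at most
  \<open>C / m\<^sup>2\<close>, which is summable, so they tend to 0 almost everywhere. Between
  consecutive squares the sums change too little to matter.\<close>

lemma AE_averages_tendsto_0: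
  fixes X :: "nat \<Rightarrow> 'a \<Rightarrow> real"
  assumes "finite_measure M"
    and meas [measurable]: "\<And>k. X k \<in> borel_measurable M" and bound: "\<And>k x. \<bar>X k x\<bar> \<le> 1"
    and var: "\<And>N. (\<integral>x. (\<Sum>k\<in>{1..N}. X k x)\<^sup>2 \<partial>M) \<le> C * real N"
  shows "AE x in M. (\<lambda>N. (\<Sum>k\<in>{1..N}. X k x) / real N) \<longlonglongrightarrow> 0"
proof -
  interpret finite_measure M by fact
  define S where "S N x = (\<Sum>k\<in>{1..N}. X k x)" for N x
  define Y where "Y m x = (S (m\<^sup>2) x / real (m\<^sup>2))\<^sup>2" for m x
  have S_meas [measurable]: "S N \<in> borel_measurable M" for N unfolding S_def by measurable
  have Y_meas [measurable]: "Y N \<in> borel_measurable M" for N unfolding Y_def by measurable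
  have S_diff: "\<bar>S N x - S M x\<bar> \<le> real N - real M" if "M \<le> N" for M N x
  proof -
    have "S N x - S M x = (\<Sum>k\<in>{1..N} - {1..M}. X k x)"
      unfolding S_def using that by (subst sum_diff) auto
    also have "\<bar>\<dots>\<bar> \<le> (\<Sum>k\<in>{1..N} - {1..M}. 1)"
      by (rule order_trans[OF sum_abs sum_mono]) (rule bound)
    also have "\<dots> = real N - real M" using that by (simp add: card_Diff_subset)
    finally show ?thesis .
  qed
  have S_bound: "\<bar>S N x\<bar> \<le> real N" for N x
    using S_diff[of 0 N x] by (simp add: S_def)
  have Y_le: "(\<integral>\<^sup>+x. ennreal (Y m x) \<partial>M) \<le> ennreal (C * (1 / real m ^ 2))" for m
  proof -
    have "integrable M (\<lambda>x. (S (m\<^sup>2) x)\<^sup>2)"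
    proof (rule integrable_const_bound)
      show "AE x in M. norm ((S (m\<^sup>2) x)\<^sup>2) \<le> (real (m\<^sup>2))\<^sup>2"
        using S_bound[of "m\<^sup>2"] by (intro AE_I2) (simp add: abs_le_square_iff[symmetric] del: of_nat_power)
    qed measurable
    then have int: "integrable M (Y m)"
      unfolding Y_def power_divide by (intro integrable_divide_zero) auto
    have "(\<integral>x. Y m x \<partial>M) = (\<integral>x. (S (m\<^sup>2) x)\<^sup>2 \<partial>M) / (real (m\<^sup>2))\<^sup>2"
      unfolding Y_def power_divide by simp
    also have "\<dots> \<le> (C * real (m\<^sup>2)) / (real (m\<^sup>2))\<^sup>2"
      unfolding S_def by (intro divide_right_mono var) auto
    also have "\<dots> = C * (1 / real m ^ 2)" by (simp add: power2_eq_square)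
    finally have "ennreal (\<integral>x. Y m x \<partial>M) \<le> ennreal (C * (1 / real m ^ 2))" by (rule ennreal_leI)
    moreover have "(\<integral>\<^sup>+x. ennreal (Y m x) \<partial>M) = ennreal (\<integral>x. Y m x \<partial>M)"
      by (intro nn_integral_eq_integral int) (simp add: Y_def)
    ultimately show ?thesis by simp
  qed
  have "0 \<le> (\<integral>x. (\<Sum>k\<in>{1..1}. X k x)\<^sup>2 \<partial>M)" by (intro integral_nonneg_AE AE_I2) simp
  from order_trans[OF this var[of 1]] have C: "C \<ge> 0" by simp
  have summable: "summable (\<lambda>m. C * (1 / real m ^ 2))"
    by (rule summable_inverse_squares)
  have "(\<integral>\<^sup>+x. (\<Sum>m. ennreal (Y m x)) \<partial>M) = (\<Sum>m. \<integral>\<^sup>+x. ennreal (Y m x) \<partial>M)"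
    by (rule nn_integral_suminf) measurable
  also have "\<dots> \<le> (\<Sum>m. ennreal (C * (1 / real m ^ 2)))"
    by (intro suminf_le Y_le summableI)
  also have "\<dots> = ennreal (\<Sum>m. C * (1 / real m ^ 2))"
    using C by (intro suminf_ennreal2 summable) simp
  finally have "(\<integral>\<^sup>+x. (\<Sum>m. ennreal (Y m x)) \<partial>M) \<noteq> \<infinity>"
    by (auto simp: top_unique)
  then have "AE x in M. (\<Sum>m. ennreal (Y m x)) \<noteq> \<infinity>"
    by (intro nn_integral_PInf_AE) auto
  then show ?thesis
  proof (rule AE_mp, intro AE_I2 impI)
    fix x assume "(\<Sum>m. ennreal (Y m x)) \<noteq> \<infinity>"
    then have "summable (\<lambda>m. Y m x)"
      by (intro summable_suminf_not_top) (auto simp: Y_def)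
    then have "(\<lambda>m. sqrt (Y m x)) \<longlonglongrightarrow> sqrt 0"
      by (intro tendsto_real_sqrt summable_LIMSEQ_zero)
    then have Y0: "(\<lambda>m. \<bar>S (m\<^sup>2) x\<bar> / real (m\<^sup>2)) \<longlonglongrightarrow> 0"
      by (simp add: Y_def abs_divide)
    \<comment> \<open>\<open>(r N)\<^sup>2\<close> is the last square up to \<open>N\<close>. With
      \<open>m = r N \<ge> 1\<close> the gap is at most \<open>2 * m + 1 \<le> 3 * m\<close>,
      negligible against \<open>m\<^sup>2\<close>.\<close>
    define r where "r N = nat \<lfloor>sqrt (real N)\<rfloor>" for N :: nat
    have r_lim: "filterlim r at_top sequentially"
      unfolding r_def
      by (intro filterlim_compose[OF filterlim_nat_sequentially] filterlim_compose[OF filterlim_floor_sequentially]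
          filterlim_compose[OF sqrt_at_top] filterlim_real_sequentially)
    have "(\<lambda>m. \<bar>S (m\<^sup>2) x\<bar> / real (m\<^sup>2) + 3 / real m) \<longlonglongrightarrow> 0 + 0"
      by (intro tendsto_add Y0 lim_const_over_n)
    then have "(\<lambda>m. \<bar>S (m\<^sup>2) x\<bar> / real (m\<^sup>2) + 3 / real m) \<longlonglongrightarrow> 0" by simp
    from filterlim_compose[OF this r_lim]
    have "(\<lambda>N. \<bar>S ((r N)\<^sup>2) x\<bar> / real ((r N)\<^sup>2) + 3 / real (r N)) \<longlonglongrightarrow> 0" .
    then show "(\<lambda>N. (\<Sum>k\<in>{1..N}. X k x) / real N) \<longlonglongrightarrow> 0"
    proof (rule Lim_null_comparison[rotated])
      show "\<forall>\<^sub>F N in sequentially. norm ((\<Sum>k\<in>{1..N}. X k x) / real N)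
          \<le> \<bar>S ((r N)\<^sup>2) x\<bar> / real ((r N)\<^sup>2) + 3 / real (r N)"
        using eventually_ge_at_top[of 1]
      proof eventually_elim
        case (elim N)
        define m where "m = r N"
        have s: "1 \<le> sqrt (real N)" using elim by simp
        then have m: "real m \<le> sqrt (real N)" "sqrt (real N) \<le> real m + 1" "real m \<ge> 1"
        proof -
          have "\<lfloor>sqrt (real N)\<rfloor> \<ge> 1" using s by simp
          then have "real m = of_int \<lfloor>sqrt (real N)\<rfloor>" "real m \<ge> 1" by (simp_all add: m_def r_def)
          then show "real m \<le> sqrt (real N)" "sqrt (real N) \<le> real m + 1" "real m \<ge> 1" by linarith+
        qed
        have "(real m)\<^sup>2 \<le> (sqrt (real N))\<^sup>2" using m by (intro power_mono) auto
        then have lo: "(real m)\<^sup>2 \<le> real N" by simp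
        have "(sqrt (real N))\<^sup>2 \<le> (real m + 1)\<^sup>2" using m by (intro power_mono) auto
        then have hi: "real N \<le> (real m)\<^sup>2 + 2 * real m + 1" by (simp add: power2_sum)
        have "m\<^sup>2 \<le> N" using lo by (metis of_nat_le_iff of_nat_power)
        have "\<bar>S N x\<bar> \<le> \<bar>S (m\<^sup>2) x\<bar> + 3 * real m"
          using S_diff[OF \<open>m\<^sup>2 \<le> N\<close>, of x] hi m by simp
        then have "\<bar>S N x\<bar> / real N \<le> (\<bar>S (m\<^sup>2) x\<bar> + 3 * real m) / (real m)\<^sup>2"
          using lo m by (intro frac_le) auto
        also have "\<dots> = \<bar>S (m\<^sup>2) x\<bar> / real (m\<^sup>2) + 3 / real m"
          using m by (simp add: add_divide_distrib power2_eq_square)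
        finally show ?case by (simp add: S_def m_def)
      qed
    qed
  qed
qed

section \<open>Digit frequencies of almost every number\<close>

text \<open>Made 1-periodic by \<open>frac\<close>, with mean 0 for Borel \<open>J\<close> in the
  unit interval. It serves twice: for digit frequencies with closed \<open>J\<close>, and for the
  sign of a cosine with the middle half of the period.\<close>

definition centered_indicator :: "real set \<Rightarrow> real \<Rightarrow> real" where
  "centered_indicator J x = indicator J (frac x) - measure lborel J"

lemma borel_measurable_frac [measurable]: "(frac :: real \<Rightarrow> real) \<in> borel_measurable borel"
  unfolding frac_def[abs_def] by measurable

lemma borel_measurable_centered_indicator [measurable]:
  assumes [measurable]: "J \<in> sets borel"
  shows "centered_indicator J \<in> borel_measurable borel"
  unfolding centered_indicator_def[abs_def] by measurable

lemma centered_indicator_periodic: "centered_indicator J (x + 1) = centered_indicator J x"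
  by (simp add: centered_indicator_def frac_1_eq)

lemma abs_centered_indicator_le:
  assumes "J \<in> sets borel" "J \<subseteq> {0..1}"
  shows "\<bar>centered_indicator J x\<bar> \<le> 1"
proof -
  have "measure lborel J \<le> measure lborel {0..1::real}"
    by (intro measure_mono_fmeasurable) (use assms in \<open>auto simp: fmeasurable_def\<close>)
  then show ?thesis by (auto simp: centered_indicator_def indicator_def)
qed

lemma integral_frac_indicator_mult:
  fixes h :: "real \<Rightarrow> real"
  assumes "J \<subseteq> {0..1}"
  shows "integral {0..1} (\<lambda>x. indicator J (frac x) * h x) = integral J h"
proof -
  have "integral {0..1} (\<lambda>x. indicator J (frac x) * h x) = integral {0..1} (\<lambda>x. if x \<in> J then h x else 0)"
    \<comment> \<open>The integrands can differ only at 1, where \<open>frac\<close> drops to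
      0.\<close>
    by (rule integral_spike[of "{1}"]) (auto simp: indicator_def frac_eq)
  also have "\<dots> = integral ({0..1} \<inter> J) h"
    by (simp only: integral_restrict_Int Int_commute)
  also have "{0..1} \<inter> J = J" using assms by auto
  finally show ?thesis .
qed

lemma integral_centered_indicator:
  assumes J: "J \<in> sets borel" "J \<subseteq> {0..1}"
  shows "integral {0..1} (centered_indicator J) = 0"
proof -
  have "(\<lambda>x. indicator J (frac x) :: real) integrable_on {0..1}"
    using J by (intro integrable_on_bounded_borel[of _ 1])
      (auto simp: indicator_def[of J] intro!: measurable_compose[OF borel_measurable_frac borel_measurable_indicator])
  then have "integral {0..1} (centered_indicator J)
      = integral {0..1} (\<lambda>x. indicator J (frac x) * 1 :: real) - integral {0..1} (\<lambda>x::real. measure lborel J)"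
    unfolding centered_indicator_def[abs_def]
    by (subst Henstock_Kurzweil_Integration.integral_diff[symmetric]) auto
  moreover have "J \<in> lmeasurable"
    using J by (intro bounded_set_imp_lmeasurable bounded_subset[OF bounded_closed_interval]) auto
  then have "integral J (\<lambda>_. 1 :: real) = measure lborel J"
    using J by (simp add: lmeasure_integral[symmetric])
  ultimately show ?thesis
    using integral_frac_indicator_mult[OF J(2), of "\<lambda>_. 1"] by simp
qed

context
  fixes c d :: real
  assumes cd: "c \<le> d" "{c..d} \<subseteq> {0..1}"
begin

lemma centered_indicator_bound: "\<bar>centered_indicator {c..d} x\<bar> \<le> 1"
  using cd by (intro abs_centered_indicator_le) auto

lemma centered_indicator_comp_integrable:
  "(\<lambda>x. centered_indicator {c..d} (r * x)) integrable_on {u..v}"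
  by (rule integrable_on_bounded_borel[OF _ centered_indicator_bound]) measurable

lemma integral_centered_indicator_Icc: "integral {0..1} (centered_indicator {c..d}) = 0"
  using cd by (intro integral_centered_indicator) auto

text \<open>The first factor is an indicator minus a constant. The constant integrates to 0 against
  the second factor; the indicator leaves the integral of a rapidly oscillating function of mean 0
  over one interval.\<close>

lemma centered_indicator_correlation:
  assumes "q > 0"
  shows "\<bar>integral {0..1} (\<lambda>x. centered_indicator {c..d} x * centered_indicator {c..d} (real q * x))\<bar> \<le> 2 / real q"
proof -
  let ?f = "centered_indicator {c..d}"
  have int: "(\<lambda>x. indicator {c..d} (frac x) * ?f (real q * x)) integrable_on {0..1}"
  proof (rule integrable_on_bounded_borel)
    show "\<bar>indicator {c..d} (frac x) * ?f (real q * x)\<bar> \<le> 1" for x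
      using centered_indicator_bound by (auto simp: indicator_def)
  qed measurable
  have int2: "(\<lambda>x. (d - c) * ?f (real q * x)) integrable_on {0..1}"
    using integrable_on_cmult_left[OF centered_indicator_comp_integrable, of "d - c" "real q"] by simp
  have f0: "integral {0..1} (\<lambda>x. ?f (real q * x)) = 0"
    using integral_periodic_stretch[of ?f q] centered_indicator_comp_integrable[of 1] assms
    by (simp add: centered_indicator_periodic integral_centered_indicator_Icc)
  have "(\<lambda>x. ?f x * ?f (real q * x)) =
      (\<lambda>x. indicator {c..d} (frac x) * ?f (real q * x) - (d - c) * ?f (real q * x))"
    using cd by (auto simp: centered_indicator_def[of _ "_ :: real"] algebra_simps fun_eq_iff)
  then have "integral {0..1} (\<lambda>x. ?f x * ?f (real q * x)) =
      integral {0..1} (\<lambda>x. indicator {c..d} (frac x) * ?f (real q * x)) -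
      integral {0..1} (\<lambda>x. (d - c) * ?f (real q * x))"
    using Henstock_Kurzweil_Integration.integral_diff[OF int int2] by simp
  also have "\<dots> = integral {c..d} (\<lambda>x. ?f (real q * x))"
    using integral_frac_indicator_mult[OF cd(2)] f0 by simp
  also have "\<bar>\<dots>\<bar> \<le> 2 / real q"
    using centered_indicator_comp_integrable[of 1] cd assms
    by (intro integral_mean_zero_stretch_bound)
      (auto simp: centered_indicator_periodic integral_centered_indicator_Icc centered_indicator_bound)
  finally show ?thesis .
qed

text \<open>The product is the 1-periodic function \<open>h\<close> stretched by
  \<open>b ^ k\<close>, and stretching by an integer preserves the integral over a period. This
  reduces to the ratio \<open>b ^ (j - k)\<close>.\<close>

lemma centered_indicator_correlation_powers:
  assumes "b \<ge> 2" "k \<le> j"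
  shows "\<bar>integral {0..1} (\<lambda>x. centered_indicator {c..d} (real b ^ k * x) * centered_indicator {c..d} (real b ^ j * x))\<bar>
    \<le> 2 * (1 / 2) ^ (j - k)"
proof -
  let ?f = "centered_indicator {c..d}"
  define h where "h x = ?f x * ?f (real (b ^ (j - k)) * x)" for x
  have "\<bar>h x\<bar> \<le> 1" for x
    unfolding h_def abs_mult using centered_indicator_bound by (intro mult_le_one) auto
  then have h_int: "h integrable_on {u..v}" for u v
    unfolding h_def[abs_def] by (intro integrable_on_bounded_borel) measurable
  have h_per: "h (x + 1) = h x" for x
  proof -
    have "real (b ^ (j - k)) * (x + 1) = real (b ^ (j - k)) + real (b ^ (j - k)) * x"
      by (simp add: algebra_simps)
    then show ?thesis
      using periodic_add_nat[of ?f, OF centered_indicator_periodic, of "b ^ (j - k)" "real (b ^ (j - k)) * x"]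
      by (simp only: h_def centered_indicator_periodic)
  qed
  have "?f (real b ^ k * x) * ?f (real b ^ j * x) = h (real (b ^ k) * x)" for x
  proof -
    have "real b ^ (j - k) * (real b ^ k * x) = real b ^ j * x"
      using assms(2) by (simp add: power_add[symmetric] mult.assoc[symmetric])
    then show ?thesis by (simp only: h_def of_nat_power)
  qed
  then have "integral {0..1} (\<lambda>x. ?f (real b ^ k * x) * ?f (real b ^ j * x)) = integral {0..1} h"
    using integral_periodic_stretch[of h "b ^ k", OF h_int h_per] assms by simp
  also have "\<bar>\<dots>\<bar> \<le> 2 / real (b ^ (j - k))"
    unfolding h_def using assms by (intro centered_indicator_correlation) auto
  also have "\<dots> \<le> 2 / 2 ^ (j - k)"
    using assms by (intro divide_left_mono) (auto intro!: power_mono)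
  also have "\<dots> = 2 * (1 / 2) ^ (j - k)" by (simp add: power_divide)
  finally show ?thesis .
qed

lemma sum_half_powers: "(\<Sum>k\<in>{1..N}. (1 / 2 :: real) ^ (Suc N - k)) = 1 - (1 / 2) ^ N"
proof (induction N)
  case (Suc N)
  have "(\<Sum>k\<in>{1..N}. (1 / 2 :: real) ^ (Suc (Suc N) - k)) = (\<Sum>k\<in>{1..N}. (1 / 2) ^ (Suc N - k)) / 2"
    unfolding sum_divide_distrib by (intro sum.cong) (auto simp: Suc_diff_le)
  then show ?case using Suc by simp
qed simp

text \<open>Each new index adds twice its correlations with the earlier ones, whose geometric bounds
  sum to at most 2, and a diagonal term of at most 2: together 6.\<close>

lemma centered_indicator_variance:
  assumes "b \<ge> 2"
  shows "integral {0..1} (\<lambda>x. (\<Sum>k\<in>{1..N}. centered_indicator {c..d} (real b ^ k * x))\<^sup>2) \<le> 6 * real N"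
proof (induction N)
  case (Suc N)
  let ?X = "\<lambda>k x. centered_indicator {c..d} (real b ^ k * x)"
  let ?S = "\<lambda>N x. \<Sum>k\<in>{1..N}. ?X k x"
  have XX_int: "(\<lambda>x. ?X k x * ?X j x) integrable_on {0..1}" for k j
  proof (rule integrable_on_bounded_borel)
    show "\<bar>?X k x * ?X j x\<bar> \<le> 1" for x
      unfolding abs_mult using centered_indicator_bound by (intro mult_le_one) auto
  qed measurable
  have S_int: "(\<lambda>x. (?S N x)\<^sup>2) integrable_on {0..1}"
    unfolding power2_eq_square sum_product by (intro integrable_sum finite_atLeastAtMost XX_int)
  have "(\<lambda>x. (?S (Suc N) x)\<^sup>2) =
      (\<lambda>x. (?S N x)\<^sup>2 + (2 * (\<Sum>k\<in>{1..N}. ?X k x * ?X (Suc N) x) + ?X (Suc N) x * ?X (Suc N) x))"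
    by (rule ext) (simp add: power2_eq_square algebra_simps sum_distrib_left sum_distrib_right)
  then have "integral {0..1} (\<lambda>x. (?S (Suc N) x)\<^sup>2) =
      integral {0..1} (\<lambda>x. (?S N x)\<^sup>2) +
      (2 * (\<Sum>k\<in>{1..N}. integral {0..1} (\<lambda>x. ?X k x * ?X (Suc N) x)) +
      integral {0..1} (\<lambda>x. ?X (Suc N) x * ?X (Suc N) x))"
    using XX_int S_int
    by (simp add: Henstock_Kurzweil_Integration.integral_add Henstock_Kurzweil_Integration.integral_sum
        integrable_add integrable_sum integrable_on_cmult_left del: power_Suc sum.cl_ivl_Suc)
  moreover have "(\<Sum>k\<in>{1..N}. integral {0..1} (\<lambda>x. ?X k x * ?X (Suc N) x)) \<le> (\<Sum>k\<in>{1..N}. 2 * (1 / 2) ^ (Suc N - k))"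
    by (intro sum_mono order_trans[OF abs_ge_self centered_indicator_correlation_powers]) (use assms in auto)
  moreover have "(\<Sum>k\<in>{1..N}. 2 * (1 / 2 :: real) ^ (Suc N - k)) \<le> 2"
    unfolding sum_distrib_left[symmetric] sum_half_powers by simp
  moreover have "integral {0..1} (\<lambda>x. ?X (Suc N) x * ?X (Suc N) x) \<le> 2 * (1 / 2) ^ (Suc N - Suc N)"
    by (intro order_trans[OF abs_ge_self centered_indicator_correlation_powers]) (use assms in auto)
  ultimately show ?case using Suc by simp
qed simp

lemma AE_frequency:
  assumes "b \<ge> 2"
  shows "AE x in lborel. x \<in> {0..1} \<longrightarrow>
    (\<lambda>N. real (card {k \<in> {1..N}. frac (real b ^ k * x) \<in> {c..d}}) / real N) \<longlonglongrightarrow> d - c"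
proof -
  let ?M = "restrict_space lborel {0..1::real}"
  let ?X = "\<lambda>k x. centered_indicator {c..d} (real b ^ k * x)"
  have "AE x in ?M. (\<lambda>N. (\<Sum>k\<in>{1..N}. ?X k x) / real N) \<longlonglongrightarrow> 0"
  proof (rule AE_averages_tendsto_0)
    show "finite_measure ?M"
      by (intro finite_measureI) (simp add: emeasure_restrict_space)
    show "?X k \<in> borel_measurable ?M" for k
      by (intro measurable_restrict_space1) measurable
    show "\<bar>?X k x\<bar> \<le> 1" for k x by (rule centered_indicator_bound)
    fix N
    have "set_integrable lborel {0..1} (\<lambda>x. (\<Sum>k\<in>{1..N}. ?X k x)\<^sup>2)"
    proof (rule set_integrable_bounded_borel)
      fix x
      have "\<bar>\<Sum>k\<in>{1..N}. ?X k x\<bar> \<le> (\<Sum>k\<in>{1..N}. 1)"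
        by (rule order_trans[OF sum_abs sum_mono]) (rule centered_indicator_bound)
      then show "\<bar>(\<Sum>k\<in>{1..N}. ?X k x)\<^sup>2\<bar> \<le> (real N)\<^sup>2" by (simp add: abs_le_square_iff[symmetric])
    qed measurable
    then have "(LINT x:{0..1}|lborel. (\<Sum>k\<in>{1..N}. ?X k x)\<^sup>2) \<le> 6 * real N"
      using centered_indicator_variance[OF assms, of N] by (simp only: set_borel_integral_eq_integral(2))
    then show "(\<integral>x. (\<Sum>k\<in>{1..N}. ?X k x)\<^sup>2 \<partial>?M) \<le> 6 * real N"
      by (simp add: integral_restrict_space set_lebesgue_integral_def)
  qed
  then have "AE x in lborel. x \<in> {0..1} \<longrightarrow> (\<lambda>N. (\<Sum>k\<in>{1..N}. ?X k x) / real N) \<longlonglongrightarrow> 0"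
    by (subst (asm) AE_restrict_space_iff) auto
  then show ?thesis
  proof (rule AE_mp, intro AE_I2 impI)
    fix x :: real
    let ?freq = "\<lambda>N. real (card {k \<in> {1..N}. frac (real b ^ k * x) \<in> {c..d}}) / real N"
    assume "x \<in> {0..1} \<longrightarrow> (\<lambda>N. (\<Sum>k\<in>{1..N}. ?X k x) / real N) \<longlonglongrightarrow> 0" "x \<in> {0..1}"
    then have "(\<lambda>N. (\<Sum>k\<in>{1..N}. ?X k x) / real N + (d - c)) \<longlonglongrightarrow> 0 + (d - c)"
      by (intro tendsto_intros) auto
    then have "(\<lambda>N. (\<Sum>k\<in>{1..N}. ?X k x) / real N + (d - c)) \<longlonglongrightarrow> d - c" by simp
    moreover have "\<forall>\<^sub>F N in sequentially. (\<Sum>k\<in>{1..N}. ?X k x) / real N + (d - c) = ?freq N"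
      using eventually_gt_at_top[of 0]
    proof eventually_elim
      case (elim N)
      have "(\<Sum>k\<in>{1..N}. indicator {c..d} (frac (real b ^ k * x)) :: real)
          = (\<Sum>k\<in>{1..N}. if frac (real b ^ k * x) \<in> {c..d} then 1 else 0)"
        by (intro sum.cong) (auto simp: indicator_def)
      also have "\<dots> = real (card {k \<in> {1..N}. frac (real b ^ k * x) \<in> {c..d}})"
        by (simp add: sum.If_cases Int_def)
      finally have "(\<Sum>k\<in>{1..N}. ?X k x)
          = real (card {k \<in> {1..N}. frac (real b ^ k * x) \<in> {c..d}}) - real N * (d - c)"
        using cd by (simp only: centered_indicator_def sum_subtractf sum_constant) simp
      then show ?case using elim by (simp only: diff_divide_distrib) simp
    qed
    ultimately show "?freq \<longlonglongrightarrow> d - c" by (rule Lim_transform_eventually)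
  qed
qed

end

text \<open>An interval is squeezed between rational ones. Rational end points leave countably many
  conditions, so that exceptional null sets can be united.\<close>

lemma equidistributed01_if_rational:
  assumes rat: "\<And>c d. \<lbrakk>c \<in> \<rat>; d \<in> \<rat>; 0 \<le> c; c \<le> d; d \<le> 1\<rbrakk> \<Longrightarrow>
    (\<lambda>N. real (card {k \<in> {1..N}. X k \<in> {c..d}}) / real N) \<longlonglongrightarrow> d - c"
    and range: "\<And>k. X k \<in> {0..1}"
  shows "equidistributed01 X"
  unfolding equidistributed01_def
proof (intro allI impI, elim conjE)
  fix c d :: real
  assume cd: "0 \<le> c" "c \<le> d" "d \<le> 1"
  let ?freq = "\<lambda>c d N. real (card {k \<in> {1..N}. X k \<in> {c..d}}) / real N"
  have mono: "?freq c d N \<le> ?freq c' d' N" if "{c..d} \<inter> {0..1} \<subseteq> {c'..d'}" for c d c' d' N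
    using that range by (intro divide_right_mono of_nat_mono card_mono) (auto simp: subset_iff)
  have "?freq c d \<longlonglongrightarrow> d - c"
  proof (rule order_tendstoI)
    fix y assume y: "y < d - c"
    show "\<forall>\<^sub>F N in sequentially. y < ?freq c d N"
    \<comment> \<open>In the second case \<open>d - c > y \<ge> 0\<close>, which leaves room for a
      nonempty rational interval inside.\<close>
    proof (cases "y < 0")
      case True
      show ?thesis
        by (intro always_eventually allI) (rule less_le_trans[OF True], simp)
    next
      case False
      define \<delta> where "\<delta> = (d - c - y) / 2"
      have \<delta>: "\<delta> > 0" using y by (simp add: \<delta>_def)
      have half: "\<delta> \<le> (d - c) / 2" using False by (simp add: \<delta>_def)
      obtain c' where c': "c' \<in> \<rat>" "c < c'" "c' < c + \<delta>" using Rats_dense_in_real[of c "c + \<delta>"] \<delta> by auto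
      obtain d' where d': "d' \<in> \<rat>" "d - \<delta> < d'" "d' < d" using Rats_dense_in_real[of "d - \<delta>" d] \<delta> by auto
      have "c' \<le> d'" using c' d' half by (simp add: field_simps)
      then have "?freq c' d' \<longlonglongrightarrow> d' - c'" using c' d' cd by (intro rat) auto
      moreover have "y < d' - c'"
      proof -
        have "d' - c' > d - c - 2 * \<delta>" using c' d' by linarith
        moreover have "2 * \<delta> = d - c - y" by (simp add: \<delta>_def)
        ultimately show ?thesis by linarith
      qed
      ultimately have "\<forall>\<^sub>F N in sequentially. y < ?freq c' d' N" by (rule order_tendstoD)
      then show ?thesis
        by (rule eventually_mono) (rule less_le_trans, assumption, rule mono, use c' d' in auto)
    qed
  next
    fix y assume y: "d - c < y"
    define \<delta> where "\<delta> = (y - (d - c)) / 2"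
    have \<delta>: "\<delta> > 0" using y by (simp add: \<delta>_def)
    obtain c1 where c1: "c1 \<in> \<rat>" "c - \<delta> < c1" "c1 < c" using Rats_dense_in_real[of "c - \<delta>" c] \<delta> by auto
    obtain d1 where d1: "d1 \<in> \<rat>" "d < d1" "d1 < d + \<delta>" using Rats_dense_in_real[of d "d + \<delta>"] \<delta> by auto
    \<comment> \<open>Clipping to the unit interval keeps the end points rational and loses nothing,
      because \<open>X\<close> takes values there.\<close>
    define c' d' where "c' = max 0 c1" and "d' = min 1 d1"
    have c': "c' \<in> \<rat>" "c - \<delta> < c'" "c' \<le> c" "0 \<le> c'" and d': "d' \<in> \<rat>" "d \<le> d'" "d' < d + \<delta>" "d' \<le> 1"
      using c1 d1 cd \<delta> by (auto simp: c'_def d'_def max_def min_def)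
    have "?freq c' d' \<longlonglongrightarrow> d' - c'" using c' d' cd by (intro rat) auto
    moreover have "d' - c' < y"
    proof -
      have "d' - c' < d - c + 2 * \<delta>" using c' d' by linarith
      moreover have "2 * \<delta> = y - (d - c)" by (simp add: \<delta>_def)
      ultimately show ?thesis by linarith
    qed
    ultimately have "\<forall>\<^sub>F N in sequentially. ?freq c' d' N < y" by (rule order_tendstoD)
    then show "\<forall>\<^sub>F N in sequentially. ?freq c d N < y"
      by (rule eventually_mono) (rule le_less_trans[rotated], assumption, rule mono, use c' d' in auto)
  qed
  then show "?freq c d \<longlonglongrightarrow> measure lebesgue {c..d}" using cd by simp
qed

lemma AE_absolutely_normal: "AE x in lborel. x \<in> {0..1} \<longrightarrow> x \<in> absolutely_normal_numbers"
proof -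
  let ?I = "{(b, c, d). (2::nat) \<le> b \<and> c \<in> \<rat> \<and> d \<in> \<rat> \<and> 0 \<le> c \<and> c \<le> d \<and> d \<le> (1::real)}"
  let ?P = "\<lambda>i x. x \<in> {0..1} \<longrightarrow> (case i of (b, c, d) \<Rightarrow>
    (\<lambda>N. real (card {k \<in> {1..N}. frac (real b ^ k * x) \<in> {c..d}}) / real N) \<longlonglongrightarrow> d - c)"
  have cnt: "countable ?I"
    by (rule countable_subset[of _ "UNIV \<times> \<rat> \<times> \<rat>"]) (auto intro!: countable_SIGMA countable_rat)
  have ae: "AE x in lborel. ?P i x" if "i \<in> ?I" for i
    using that AE_frequency by (auto split: prod.splits)
  have "AE x in lborel. \<forall>i\<in>?I. ?P i x"
    by (rule iffD2[OF AE_ball_countable[OF cnt]]) (intro ballI ae)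
  then show ?thesis
  proof (rule AE_mp, intro AE_I2 impI)
    fix x :: real assume "\<forall>i\<in>?I. ?P i x" "x \<in> {0..1}"
    then show "x \<in> absolutely_normal_numbers"
      unfolding absolutely_normal_numbers_def normal_to_base_def
      by (intro CollectI allI impI equidistributed01_if_rational)
        (auto simp: frac_ge_0 less_imp_le[OF frac_lt_1])
  qed
qed

text \<open>Inner regularity, giving up less than half of a set of measure 1.\<close>

lemma compact_absolutely_normal:
  obtains K where "compact K" "K \<subseteq> {0..1}" "K \<subseteq> absolutely_normal_numbers" "measure lborel K > 0"
proof -
  from AE_absolutely_normal obtain N where
    N: "{x. \<not> (x \<in> {0..1} \<longrightarrow> x \<in> absolutely_normal_numbers)} \<subseteq> N" "N \<in> sets lborel" "emeasure lborel N = 0"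
    by (auto elim!: AE_E)
  define S where "S = {0..1} - N"
  have S: "S \<in> sets borel" using N by (simp add: S_def)
  have "emeasure lborel S = 1"
    using N emeasure_Diff_null_set[of N lborel "{0..1}"] by (simp add: S_def null_sets_def)
  obtain K where K: "closed K" "K \<subseteq> S" "S - K \<in> lmeasurable" "emeasure lebesgue (S - K) < ennreal (1 / 2)"
    using sets_lebesgue_inner_closed[of S "1/2"] S by auto
  show thesis
  proof
    show "K \<subseteq> {0..1}" using K(2) unfolding S_def by blast
    show "K \<subseteq> absolutely_normal_numbers" using K(2) N(1) unfolding S_def by blast
    show "compact K" using K \<open>K \<subseteq> {0..1}\<close> by (meson bounded_closed_interval bounded_subset compact_eq_bounded_closed)
    have "K \<in> sets borel" using K by simp
    then have "emeasure lborel S \<le> emeasure lborel (S - K) + emeasure lborel K"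
      using K(2) S by (subst plus_emeasure) (auto intro!: emeasure_mono)
    moreover have "emeasure lborel (S - K) < ennreal (1 / 2)"
      using K S \<open>K \<in> sets borel\<close> by simp
    moreover have "ennreal (1 / 2) < 1" by (subst ennreal_1[symmetric], subst ennreal_less_iff) auto
    ultimately have "emeasure lborel K \<noteq> 0"
      using \<open>emeasure lborel S = 1\<close> by (metis add.right_neutral leD order_less_trans)
    moreover have "emeasure lborel K \<noteq> \<infinity>"
      using emeasure_compact_finite[OF \<open>compact K\<close>] by simp
    ultimately show "measure lborel K > 0"
      by (metis emeasure_eq_ennreal_measure ennreal_0 infinity_ennreal_def measure_nonneg order_less_le)
  qed
qed


section \<open>Construction of the set\<close>

definition cos_nonneg_set :: "nat \<Rightarrow> real set" where
  "cos_nonneg_set n = {x. cos (2 * pi * real n * x) \<ge> 0}"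

lemma closed_cos_nonneg_set: "closed (cos_nonneg_set n)"
  unfolding cos_nonneg_set_def by (intro closed_Collect_le continuous_intros)

lemma borel_cos_nonneg_set [measurable]: "cos_nonneg_set n \<in> sets borel"
  by (simp add: borel_closed closed_cos_nonneg_set)

lemma cos_nonneg_iff_frac: "cos (2 * pi * y) \<ge> 0 \<longleftrightarrow> frac y \<notin> {1/4<..<3/4}"
proof -
  define t where "t = frac y"
  have t: "0 \<le> t" "t < 1" by (simp_all add: t_def frac_ge_0 frac_lt_1)
  have "y = t + of_int \<lfloor>y\<rfloor>" by (simp add: t_def frac_def)
  then have "2 * pi * y = 2 * pi * t + 2 * pi * of_int \<lfloor>y\<rfloor>" by (metis distrib_left)
  then have "cos (2 * pi * y) = cos (2 * pi * t)"
    by (simp add: cos_add)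
  moreover have "cos (2 * pi * t) \<ge> 0 \<longleftrightarrow> t \<notin> {1/4<..<3/4}"
  proof (cases "t \<in> {1/4<..<3/4}")
    case True
    then have "pi * (1/4) < pi * t" "pi * t < pi * (3/4)" by simp_all
    then have "cos (2 * pi * t - pi) > 0" by (intro cos_gt_zero_pi) linarith+
    then show ?thesis using True by simp
  next
    case False
    then consider "t \<le> 1/4" | "3/4 \<le> t" by force
    then show ?thesis
    proof cases
      case 1
      then have "0 \<le> pi * t" "pi * t \<le> pi * (1/4)" using t by simp_all
      then have "cos (2 * pi * t) \<ge> 0" using pi_gt_zero by (intro cos_ge_zero) linarith+
      then show ?thesis using False by simp
    next
      case 2
      then have "pi * t \<le> pi * 1" "pi * (3/4) \<le> pi * t" using t by simp_all
      then have "cos (2 * pi - 2 * pi * t) \<ge> 0" using pi_gt_zero by (intro cos_ge_zero) linarith+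
      then show ?thesis using False by (simp add: cos_diff)
    qed
  qed
  ultimately show ?thesis by (simp add: t_def)
qed

text \<open>The indicator of \<open>cos_nonneg_set n\<close> is \<open>1 / 2\<close> minus a
  stretched centred indicator of the middle half period, whose integral is at most
  \<open>2 / n\<close> in size.\<close>

lemma measure_Icc_cos_nonneg_set:
  assumes "n > 0" "0 \<le> u" "u \<le> v"
  shows "\<bar>measure lborel ({u..v} \<inter> cos_nonneg_set n) - (v - u) / 2\<bar> \<le> 2 / real n"
proof -
  let ?g = "centered_indicator {1/4<..<3/4}"
  have bound: "\<bar>?g x\<bar> \<le> 1" for x by (intro abs_centered_indicator_le) auto
  have int: "?g integrable_on {a..b}" for a b
    by (rule integrable_on_bounded_borel[OF _ bound]) measurable
  have int': "(\<lambda>x. ?g (real n * x)) integrable_on {u..v}"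
    by (rule integrable_on_bounded_borel[OF _ bound]) measurable
  have "({u..v} \<inter> cos_nonneg_set n) \<in> lmeasurable"
    by (intro bounded_set_imp_lmeasurable bounded_Int) auto
  then have "measure lborel ({u..v} \<inter> cos_nonneg_set n) = integral ({u..v} \<inter> cos_nonneg_set n) (\<lambda>_. 1)"
    by (simp add: lmeasure_integral[symmetric])
  also have "\<dots> = integral {u..v} (\<lambda>x. if x \<in> cos_nonneg_set n then 1 else 0)"
    by (simp only: integral_restrict_Int Int_commute)
  also have "\<dots> = integral {u..v} (\<lambda>x. 1 / 2 - ?g (real n * x))"
    by (intro Henstock_Kurzweil_Integration.integral_cong)
      (use cos_nonneg_iff_frac[of "real n * _"] in \<open>auto simp: cos_nonneg_set_def centered_indicator_def mult.assoc indicator_def\<close>)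
  also have "\<dots> = (v - u) / 2 - integral {u..v} (\<lambda>x. ?g (real n * x))"
    using int' assms by (subst Henstock_Kurzweil_Integration.integral_diff) auto
  finally have "measure lborel ({u..v} \<inter> cos_nonneg_set n) - (v - u) / 2 = - integral {u..v} (\<lambda>x. ?g (real n * x))"
    by simp
  moreover have "\<bar>integral {u..v} (\<lambda>x. ?g (real n * x))\<bar> \<le> 2 / real n"
    using assms
    by (intro integral_mean_zero_stretch_bound int bound centered_indicator_periodic integral_centered_indicator) auto
  ultimately show ?thesis by simp
qed

text \<open>Passes from intervals to Borel sets by Dynkin's pi-lambda induction. Cutting with the
  unit interval keeps all measures finite, so complements become differences.\<close>

lemma measure_cos_nonneg_set_tendsto:
  assumes "S \<in> sets borel"
  shows "(\<lambda>n. measure lborel (S \<inter> {0..1} \<inter> cos_nonneg_set n)) \<longlonglongrightarrow> measure lborel (S \<inter> {0..1}) / 2"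
proof -
  let ?G = "range (\<lambda>(a, b). {a..b::real})"
  have fin: "emeasure lborel (S \<inter> {0..1} \<inter> T) \<noteq> \<infinity>" for S T :: "real set"
  proof -
    have "emeasure lborel (S \<inter> {0..1} \<inter> T) \<le> emeasure lborel {0..1::real}" by (intro emeasure_mono) auto
    then show ?thesis by (auto simp: top_unique)
  qed
  have borel: "S \<in> sets borel" if "S \<in> sigma_sets UNIV ?G" for S
    using that by (simp add: borel_eq_atLeastAtMost)
  have "Int_stable ?G" by (auto simp: Int_stable_def)
  moreover have "?G \<subseteq> Pow UNIV" by simp
  moreover have "S \<in> sigma_sets UNIV ?G" using assms by (simp add: borel_eq_atLeastAtMost)
  ultimately show ?thesis
  proof (induction rule: sigma_sets_induct_disjoint)
    case (basic A)
    then obtain a b where A: "A = {a..b}" by auto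
    show ?case
    proof (cases "max a 0 \<le> min b 1")
      case True
      have "A \<inter> {0..1} = {max a 0..min b 1}" using A by auto
      moreover have "(\<lambda>n. measure lborel ({max a 0..min b 1} \<inter> cos_nonneg_set n)) \<longlonglongrightarrow> (min b 1 - max a 0) / 2"
      proof (rule LIM_zero_cancel, rule Lim_null_comparison)
        show "\<forall>\<^sub>F n in sequentially. norm (measure lborel ({max a 0..min b 1} \<inter> cos_nonneg_set n) - (min b 1 - max a 0) / 2) \<le> 2 / real n"
          using eventually_gt_at_top[of 0]
          by eventually_elim (use True measure_Icc_cos_nonneg_set[of _ "max a 0" "min b 1"] in simp)
      qed (rule lim_const_over_n)
      ultimately show ?thesis using True by simp
    next
      case False
      then have "A \<inter> {0..1} = {}" using A by auto
      then show ?thesis by simp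
    qed
  next
    case empty
    then show ?case by simp
  next
    case (compl A)
    have A: "A \<in> sets borel" using borel compl by blast
    have m: "measure lborel ((UNIV - A) \<inter> {0..1} \<inter> T) = measure lborel ({0..1} \<inter> T) - measure lborel (A \<inter> {0..1} \<inter> T)"
      if "T \<in> sets borel" for T
    proof -
      have eq: "(UNIV - A) \<inter> {0..1} \<inter> T = {0..1} \<inter> T - A \<inter> {0..1} \<inter> T" by auto
      show ?thesis
        unfolding eq by (rule measure_Diff) (use fin[of UNIV T] A that in auto)
    qed
    have "(\<lambda>n. measure lborel ({0..1} \<inter> cos_nonneg_set n)) \<longlonglongrightarrow> 1 / 2"
    proof (rule LIM_zero_cancel, rule Lim_null_comparison)
      show "\<forall>\<^sub>F n in sequentially. norm (measure lborel ({0..1} \<inter> cos_nonneg_set n) - 1 / 2) \<le> 2 / real n"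
        using eventually_gt_at_top[of 0]
        by eventually_elim (use measure_Icc_cos_nonneg_set[of _ 0 1] in simp)
    qed (rule lim_const_over_n)
    from tendsto_diff[OF this compl.IH]
    show ?case using m m[of UNIV] by (simp add: diff_divide_distrib)
  next
    case (union A)
    have A: "A i \<in> sets borel" for i using borel union by blast
    have sums: "(\<lambda>i. measure lborel (A i \<inter> {0..1} \<inter> T)) sums measure lborel (\<Union> (range A) \<inter> {0..1} \<inter> T)"
      if "T \<in> sets borel" for T
    proof -
      have eq: "(\<Union>i. A i \<inter> {0..1} \<inter> T) = \<Union> (range A) \<inter> {0..1} \<inter> T" by auto
      have "disjoint_family (\<lambda>i. A i \<inter> {0..1} \<inter> T)"
        using \<open>disjoint_family A\<close> by (auto simp: disjoint_family_on_def)
      then show ?thesis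
        unfolding eq[symmetric]
        by (rule measure_UNION[rotated]) (use A that fin[of "\<Union> (range A)" T] in \<open>auto simp: eq\<close>)
    qed
    have sums': "(\<lambda>i. measure lborel (A i \<inter> {0..1})) sums measure lborel (\<Union> (range A) \<inter> {0..1})"
      using sums[of UNIV] by simp
    have "((\<lambda>n. \<Sum>i. measure lborel (A i \<inter> {0..1} \<inter> cos_nonneg_set n)) \<longlongrightarrow> (\<Sum>i. measure lborel (A i \<inter> {0..1}) / 2)) sequentially"
    \<comment> \<open>Dominated convergence for series: the measures of the uncut pieces are a
      summable majorant.\<close>
    proof (rule tannerys_theorem[THEN conjunct2, THEN conjunct2])
      show "(\<lambda>n. measure lborel (A i \<inter> {0..1} \<inter> cos_nonneg_set n)) \<longlonglongrightarrow> measure lborel (A i \<inter> {0..1}) / 2" for i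
        by (rule union.IH)
      have "measure lborel (A i \<inter> {0..1} \<inter> cos_nonneg_set n) \<le> measure lborel (A i \<inter> {0..1})" for i n
        using A fin[of "A i" UNIV] by (intro measure_mono_fmeasurable) (auto simp: fmeasurable_def top.not_eq_extremum)
      then show "\<forall>\<^sub>F (i, n) in at_top \<times>\<^sub>F sequentially.
          norm (measure lborel (A i \<inter> {0..1} \<inter> cos_nonneg_set n)) \<le> measure lborel (A i \<inter> {0..1})"
        by (intro always_eventually) auto
    qed (use sums' in \<open>auto intro: sums_summable\<close>)
    moreover have "(\<Sum>i. measure lborel (A i \<inter> {0..1}) / 2) = measure lborel (\<Union> (range A) \<inter> {0..1}) / 2"
      using sums_divide[OF sums', of 2] by (simp add: sums_iff)
    ultimately show ?case using sums by (simp add: sums_iff)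
  qed
qed

text \<open>Neighbouring cells share an end point, which is harmless since cells are only used to
  bound masses from above. Indices up to and including \<open>2 ^ l\<close> are used, the last one
  to cover the point 1.\<close>

definition dyadic :: "nat \<Rightarrow> nat \<Rightarrow> real set" where
  "dyadic l i = {real i / 2 ^ l..(real i + 1) / 2 ^ l}"

lemma measure_lborel_mono:
  assumes "S \<subseteq> T" "S \<in> sets borel" "T \<in> sets borel" "bounded T"
  shows "measure lborel S \<le> measure lborel (T :: real set)"
  using assms bounded_set_imp_lmeasurable[of T]
  by (intro measure_mono_fmeasurable) (auto simp: fmeasurable_def)

lemma measure_Int_dyadic_le:
  assumes "S \<in> sets borel"
  shows "measure lborel (S \<inter> dyadic l i) \<le> (1 / 2) ^ l"
proof -
  have "measure lborel (S \<inter> dyadic l i) \<le> measure lborel (dyadic l i)"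
    using assms by (intro measure_lborel_mono) (auto simp: dyadic_def)
  also have "\<dots> = (1 / 2) ^ l" by (simp add: dyadic_def diff_divide_distrib[symmetric] power_divide divide_right_mono)
  finally show ?thesis .
qed

text \<open>Only finitely many cells have level at most \<open>L\<close>, so the individual limits
  hold within \<delta> for a common \<open>n\<close>.\<close>

lemma exists_halving_frequency:
  assumes "compact K" "K \<subseteq> {0..1}" "\<delta> > 0"
  shows "\<exists>n>B. \<forall>l\<le>L. \<forall>i\<le>2^l.
    \<bar>2 * measure lborel (K \<inter> cos_nonneg_set n \<inter> dyadic l i) - measure lborel (K \<inter> dyadic l i)\<bar> \<le> \<delta>"
proof -
  have "\<forall>\<^sub>F n in sequentially.
      \<bar>2 * measure lborel (K \<inter> cos_nonneg_set n \<inter> dyadic l i) - measure lborel (K \<inter> dyadic l i)\<bar> < \<delta>" for l i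
  proof -
    have "K \<inter> dyadic l i \<in> sets borel"
      using assms by (intro sets.Int) (auto simp: dyadic_def intro: borel_compact)
    moreover have "K \<inter> dyadic l i \<inter> {0..1} = K \<inter> dyadic l i"
      "K \<inter> dyadic l i \<inter> {0..1} \<inter> cos_nonneg_set n = K \<inter> cos_nonneg_set n \<inter> dyadic l i" for n
      using assms(2) by auto
    ultimately have "(\<lambda>n. measure lborel (K \<inter> cos_nonneg_set n \<inter> dyadic l i)) \<longlonglongrightarrow> measure lborel (K \<inter> dyadic l i) / 2"
      using measure_cos_nonneg_set_tendsto[of "K \<inter> dyadic l i"] by simp
    from tendsto_mult_left[OF this, of 2] assms(3) show ?thesis
      by (auto simp: dist_real_def dest!: tendstoD)
  qed
  then have "\<forall>\<^sub>F n in sequentially. \<forall>l\<in>{..L}. \<forall>i\<in>{..2^l}.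
      \<bar>2 * measure lborel (K \<inter> cos_nonneg_set n \<inter> dyadic l i) - measure lborel (K \<inter> dyadic l i)\<bar> < \<delta>"
    by (intro eventually_ball_finite ballI) auto
  then have "\<forall>\<^sub>F n in sequentially. n > B \<and> (\<forall>l\<in>{..L}. \<forall>i\<in>{..2^l}.
      \<bar>2 * measure lborel (K \<inter> cos_nonneg_set n \<inter> dyadic l i) - measure lborel (K \<inter> dyadic l i)\<bar> < \<delta>)"
    using eventually_gt_at_top[of B] by eventually_elim simp
  then show ?thesis by (auto dest!: eventually_happens'[rotated] intro: less_imp_le)
qed

section \<open>Mass distribution principle\<close>

text \<open>Continuity of \<phi> lets a covering set be replaced by a slightly longer open interval
  at cost \<open>e\<close>, which makes compactness applicable to the cover.\<close>

lemma enlarge_to_open_interval: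
  fixes \<phi> :: "real \<Rightarrow> real" and U :: "real set"
  assumes "continuous_on {0..} \<phi>" "bounded U" "e > 0" "diameter U < \<eta>"
  obtains a b where "a < b" "b - a < \<eta>" "U \<subseteq> {a<..<b}" "\<phi> (b - a) \<le> \<phi> (diameter U) + e"
proof -
  define D where "D = diameter U"
  have D: "D \<ge> 0" using assms by (simp add: D_def diameter_ge_0)
  obtain d where d: "d > 0" "\<And>r. \<lbrakk>r \<ge> 0; dist r D < d\<rbrakk> \<Longrightarrow> dist (\<phi> r) (\<phi> D) < e"
    using assms(1,3) D unfolding continuous_on_iff by (metis atLeast_iff)
  define t where "t = min d (\<eta> - D) / 4"
  have t: "t > 0" "2 * t < d" "2 * t < \<eta> - D"
    using d assms(4) by (auto simp: t_def D_def min_def)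
  show thesis
  proof
    show "Inf U - t < Inf U + D + t" using t D by simp
    show "Inf U + D + t - (Inf U - t) < \<eta>" using t by simp
    have "x \<in> {Inf U - t<..<Inf U + D + t}" if x: "x \<in> U" for x
    proof -
      have "bdd_below U" using assms(2) by (rule bounded_imp_bdd_below)
      then have "Inf U \<le> x" using x by (intro cInf_lower)
      moreover have "x - D \<le> Inf U"
      proof (rule cInf_greatest)
        show "U \<noteq> {}" using x by auto
        fix y assume "y \<in> U"
        then show "x - D \<le> y"
          using diameter_bounded_bound[OF assms(2) x, of y] by (simp add: D_def dist_real_def)
      qed
      ultimately show ?thesis using t by simp
    qed
    then show "U \<subseteq> {Inf U - t<..<Inf U + D + t}" by blast
    have "dist (\<phi> (D + 2 * t)) (\<phi> D) < e" using t D by (intro d(2)) (auto simp: dist_real_def)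
    then show "\<phi> (Inf U + D + t - (Inf U - t)) \<le> \<phi> (diameter U) + e"
      by (simp add: dist_real_def D_def algebra_simps abs_less_iff)
  qed
qed

text \<open>Otherwise the compact sets \<open>K k - T\<close> would be nested and nonempty, hence
  have a common point.\<close>

lemma compact_decseq_subset_open:
  fixes K :: "nat \<Rightarrow> 'a::heine_borel set"
  assumes "\<And>k. compact (K k)" "\<And>k. K (Suc k) \<subseteq> K k" "(\<Inter>k. K k) \<subseteq> T" "open T"
  obtains k where "K k \<subseteq> T"
proof (rule ccontr)
  assume "\<not> thesis"
  then have ne: "K k - T \<noteq> {}" for k using that by blast
  have "decseq K" using assms(2) by (simp add: decseq_Suc_iff)
  then have "\<Inter>(range (\<lambda>k. K k - T)) \<noteq> {}"
    using assms(1,4) ne by (intro compact_nest compact_diff) (auto simp: decseq_def)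
  then show False using assms(3) by blast
qed

text \<open>A mass distribution principle for the weak limit of the measures \<open>w k\<close> times Lebesgue
  measure on \<open>K k\<close>, which avoids constructing that limit.\<close>

lemma hausdorff_measure_pos:
  fixes \<phi> :: "real \<Rightarrow> real" and K :: "nat \<Rightarrow> real set"
  assumes cont: "continuous_on {0..} \<phi>" and nonneg: "\<And>r. r \<ge> 0 \<Longrightarrow> \<phi> r \<ge> 0"
    and K: "\<And>k. compact (K k)" "\<And>k. K (Suc k) \<subseteq> K k"
    and w: "\<And>k. w k \<ge> 0" and "c > 0" "C > 0" "\<eta> > 0"
    and mass: "\<And>k. c \<le> w k * measure lborel (K k)"
    and upper: "\<And>k a b. \<lbrakk>a < b; b - a < \<eta>\<rbrakk> \<Longrightarrow> w k * measure lborel (K k \<inter> {a..b}) \<le> C * \<phi> (b - a)"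
  shows "hausdorff_measure \<phi> (\<Inter>k. K k) > 0"
proof -
  \<comment> \<open>A cover yields \<open>c / C\<close> at most its sum plus the total enlargement
    cost \<open>e\<close>; with \<open>c / C = 2 * e\<close> the sum is at least
    \<open>e\<close>.\<close>
  define e where "e = c / (2 * C)"
  have e: "e > 0" using assms by (simp add: e_def)
  have "ennreal e \<le> hausdorff_premeasure \<phi> (\<eta> / 2) (\<Inter>k. K k)"
    unfolding hausdorff_premeasure_def
  proof (rule INF_greatest)
    fix U :: "nat \<Rightarrow> real set"
    assume "U \<in> {U. (\<Inter>k. K k) \<subseteq> (\<Union>i. U i) \<and> (\<forall>i. bounded (U i) \<and> diameter (U i) \<le> \<eta> / 2)}"
    then have U: "(\<Inter>k. K k) \<subseteq> (\<Union>i. U i)" "\<And>i. bounded (U i)" "\<And>i. diameter (U i) \<le> \<eta> / 2" by auto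
    have "\<exists>a b. a < b \<and> b - a < \<eta> \<and> U i \<subseteq> {a<..<b} \<and> \<phi> (b - a) \<le> \<phi> (diameter (U i)) + e * (1 / 2) ^ Suc i" for i
    proof -
      have "diameter (U i) < \<eta>" using U(3)[of i] \<open>\<eta> > 0\<close> by linarith
      moreover have "e * (1 / 2) ^ Suc i > 0" using e by simp
      ultimately show ?thesis
        using enlarge_to_open_interval[OF cont U(2)] by metis
    qed
    then obtain a b where ab: "\<And>i. a i < b i" "\<And>i. b i - a i < \<eta>" "\<And>i. U i \<subseteq> {a i<..<b i}"
      "\<And>i. \<phi> (b i - a i) \<le> \<phi> (diameter (U i)) + e * (1 / 2) ^ Suc i"
      by metis
    \<comment> \<open>An open cover of the intersection already covers a single \<open>K k\<close>,
      where \<open>mass\<close> and \<open>upper\<close> apply.\<close>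
    have "(\<Inter>k. K k) \<subseteq> (\<Union>i. {a i<..<b i})" using U(1) ab(3) by blast
    moreover have "open (\<Union>i. {a i<..<b i})" by auto
    ultimately obtain k where k: "K k \<subseteq> (\<Union>i. {a i<..<b i})"
      by (rule compact_decseq_subset_open[of K, OF K])
    obtain I where I: "finite I" "K k \<subseteq> (\<Union>i\<in>I. {a i<..<b i})"
      by (rule compactE_image[OF K(1) _ k]) auto
    have "K k = (\<Union>i\<in>I. K k \<inter> {a i..b i})" using I(2) by force
    moreover have "measure lborel (\<Union>i\<in>I. K k \<inter> {a i..b i}) \<le> (\<Sum>i\<in>I. measure lborel (K k \<inter> {a i..b i}))"
      using I(1) K(1) by (intro measure_UNION_le) (auto intro: borel_compact)
    ultimately have "measure lborel (K k) \<le> (\<Sum>i\<in>I. measure lborel (K k \<inter> {a i..b i}))" by simp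
    then have "w k * measure lborel (K k) \<le> w k * (\<Sum>i\<in>I. measure lborel (K k \<inter> {a i..b i}))"
      using w by (rule mult_left_mono)
    with mass[of k] have "c \<le> (\<Sum>i\<in>I. w k * measure lborel (K k \<inter> {a i..b i}))"
      by (simp add: sum_distrib_left)
    also have "\<dots> \<le> (\<Sum>i\<in>I. C * \<phi> (b i - a i))" by (intro sum_mono upper ab)
    also have "\<dots> \<le> (\<Sum>i\<in>I. C * (\<phi> (diameter (U i)) + e * (1 / 2) ^ Suc i))"
      using \<open>C > 0\<close> by (intro sum_mono mult_left_mono ab) auto
    also have "\<dots> = C * ((\<Sum>i\<in>I. \<phi> (diameter (U i))) + e * (\<Sum>i\<in>I. (1 / 2) ^ Suc i))"
      by (simp add: sum_distrib_left sum.distrib distrib_left)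
    also have "\<dots> \<le> C * ((\<Sum>i\<in>I. \<phi> (diameter (U i))) + e * 1)"
    proof -
      have "(\<Sum>i\<in>I. (1 / 2 :: real) ^ Suc i) \<le> (\<Sum>i. (1 / 2) ^ Suc i)"
        using I(1) power_half_series by (intro sum_le_suminf) (auto simp: sums_iff)
      also have "\<dots> = 1" using power_half_series by (simp add: sums_iff)
      finally show ?thesis using e \<open>C > 0\<close> by (intro mult_left_mono add_left_mono) auto
    qed
    finally have "c / C \<le> (\<Sum>i\<in>I. \<phi> (diameter (U i))) + e" using \<open>C > 0\<close> by (simp add: pos_divide_le_eq mult.commute)
    moreover have "c / C = e + e" using \<open>C > 0\<close> by (simp add: e_def)
    ultimately have "e \<le> (\<Sum>i\<in>I. \<phi> (diameter (U i)))" by simp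
    then have "ennreal e \<le> ennreal (\<Sum>i\<in>I. \<phi> (diameter (U i)))" by (rule ennreal_leI)
    also have "\<dots> = (\<Sum>i\<in>I. ennreal (\<phi> (diameter (U i))))"
      using nonneg U(2) by (intro sum_ennreal[symmetric]) (simp add: diameter_ge_0)
    also have "\<dots> \<le> (\<Sum>i. ennreal (\<phi> (diameter (U i))))"
      using I(1) by (intro sum_le_suminf) auto
    finally show "ennreal e \<le> (\<Sum>i. ennreal (\<phi> (diameter (U i))))" .
  qed
  also have "\<dots> \<le> hausdorff_measure \<phi> (\<Inter>k. K k)"
    unfolding hausdorff_measure_eq_SUP using \<open>\<eta> > 0\<close> by (intro SUP_upper) auto
  finally show ?thesis using e by (metis ennreal_less_zero_iff order_less_le_trans)
qed

section \<open>Dyadic masses along the halving sequence\<close>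

text \<open>For the least \<open>l\<close> with \<open>(1 / 2) ^ l \<le> b - a\<close>, the interval
  scaled by \<open>2 ^ l\<close> is shorter than 2, so its points have at most three integer
  parts.\<close>

lemma Icc_subset_three_dyadics:
  fixes a b :: real
  assumes "0 < b - a" "b - a < 1"
  obtains l I where "(1 / 2) ^ l \<le> b - a" "finite I" "card I \<le> 3" "I \<subseteq> {..2 ^ l}"
    "{a..b} \<inter> {0..1} \<subseteq> (\<Union>i\<in>I. dyadic l i)"
proof -
  define d where "d = b - a"
  have "\<exists>l. (1 / 2 :: real) ^ l \<le> d"
    using real_arch_pow_inv[of d "1/2"] assms by (auto simp: d_def intro: less_imp_le)
  define l where "l = (LEAST l. (1 / 2 :: real) ^ l \<le> d)"
  have l: "(1 / 2) ^ l \<le> d" unfolding l_def by (rule LeastI_ex) fact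
  have "l \<noteq> 0"
  proof
    assume "l = 0"
    then show False using l assms(2) by (simp add: d_def)
  qed
  then have "\<not> (1 / 2) ^ (l - 1) \<le> d" unfolding l_def by (intro not_less_Least) (simp add: l_def)
  then have "d < 2 * (1 / 2) ^ l" using \<open>l \<noteq> 0\<close> by (cases l) auto
  then have d: "2 ^ l * d < 2" by (simp add: power_divide field_simps)
  define j where "j = \<lfloor>2 ^ l * a\<rfloor>"
  \<comment> \<open>A negative index is sent to 0 by \<open>nat\<close>; points of the unit interval
    never produce one.\<close>
  define I where "I = nat ` {j, j + 1, j + 2} \<inter> {..2 ^ l}"
  have "{a..b} \<inter> {0..1} \<subseteq> (\<Union>i\<in>I. dyadic l i)"
  proof
    fix x assume x: "x \<in> {a..b} \<inter> {0..1}"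
    define i where "i = \<lfloor>2 ^ l * x\<rfloor>"
    have "2 ^ l * a \<le> 2 ^ l * x" "2 ^ l * x \<le> 2 ^ l * b" using x by auto
    moreover have "2 ^ l * b = 2 ^ l * a + 2 ^ l * d" by (simp add: d_def algebra_simps)
    ultimately have "j \<le> i" "i < j + 3" using d unfolding i_def j_def by linarith+
    then have "i \<in> {j, j + 1, j + 2}" by auto
    moreover have "2 ^ l * x \<le> 2 ^ l" "0 \<le> 2 ^ l * x" using x by (auto simp: mult_le_cancel_left1)
    then have i0: "0 \<le> i" "real_of_int i \<le> 2 ^ l" unfolding i_def by linarith+
    then have "real (nat i) \<le> real (2 ^ l)" by simp
    then have "nat i \<le> 2 ^ l" by (simp only: of_nat_le_iff)
    ultimately have "nat i \<in> I" unfolding I_def by blast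
    moreover have "real_of_int i \<le> 2 ^ l * x" "2 ^ l * x \<le> real_of_int i + 1"
      unfolding i_def by linarith+
    then have "x \<in> dyadic l (nat i)" using i0 by (simp add: dyadic_def field_simps)
    ultimately show "x \<in> (\<Union>i\<in>I. dyadic l i)" by blast
  qed
  moreover have "card I \<le> 3"
  proof -
    have "card I \<le> card (nat ` {j, j + 1, j + 2})" unfolding I_def by (intro card_mono) auto
    also have "\<dots> \<le> card {j, j + 1, j + 2}" by (rule card_image_le) auto
    also have "\<dots> \<le> 3" by (simp add: card_insert_if)
    finally show ?thesis .
  qed
  ultimately show thesis using l that[of l I] by (auto simp: I_def d_def)
qed

text \<open>In the tolerance, one \<open>k\<close> of the exponent offsets the weight
  \<open>2 ^ k\<close> of the normalised masses. What remains is summable over \<open>k\<close> and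
  small against \<open>(1 / 2) ^ l\<close> for every level \<open>l \<le> L k\<close>.\<close>

lemma halving_construction:
  fixes L :: "nat \<Rightarrow> nat"
  assumes K0: "compact K0" "K0 \<subseteq> {0..1}" "measure lborel K0 > 0"
  obtains K where "K 0 = K0" "\<And>k. compact (K k)" "\<And>k. K (Suc k) \<subseteq> K k"
    "\<And>k. \<exists>n>k. K (Suc k) \<subseteq> cos_nonneg_set n"
    "\<And>k l i. \<lbrakk>l \<le> L k; i \<le> 2 ^ l\<rbrakk> \<Longrightarrow>
      \<bar>2 * measure lborel (K (Suc k) \<inter> dyadic l i) - measure lborel (K k \<inter> dyadic l i)\<bar>
        \<le> measure lborel K0 * (1 / 2) ^ (L k + 2 * k + 2)"
proof -
  \<comment> \<open>The clause for \<open>k = 0\<close> pins the first set of the dependent choice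
    to \<open>K0\<close>.\<close>
  let ?P = "\<lambda>(k::nat) K. compact K \<and> K \<subseteq> {0..1} \<and> (k = 0 \<longrightarrow> K = K0)"
  let ?Q = "\<lambda>(k::nat) K K'. \<exists>n>k. K' = K \<inter> cos_nonneg_set n \<and> (\<forall>l\<le>L k. \<forall>i\<le>2^l.
    \<bar>2 * measure lborel (K' \<inter> dyadic l i) - measure lborel (K \<inter> dyadic l i)\<bar>
      \<le> measure lborel K0 * (1 / 2) ^ (L k + 2 * k + 2))"
  have "\<exists>K. \<forall>k. ?P k (K k) \<and> ?Q k (K k) (K (Suc k))"
  proof (rule dependent_nat_choice)
    show "\<exists>K. ?P 0 K" using K0 by auto
    fix K k assume K: "?P k K"
    then obtain n where n: "n > k" "\<forall>l\<le>L k. \<forall>i\<le>2^l.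
      \<bar>2 * measure lborel (K \<inter> cos_nonneg_set n \<inter> dyadic l i) - measure lborel (K \<inter> dyadic l i)\<bar>
        \<le> measure lborel K0 * (1 / 2) ^ (L k + 2 * k + 2)"
      using exists_halving_frequency[of K "measure lborel K0 * (1 / 2) ^ (L k + 2 * k + 2)" k "L k"] K0 by auto
    moreover have "compact (K \<inter> cos_nonneg_set n)"
      using K by (intro compact_Int_closed closed_cos_nonneg_set) auto
    ultimately show "\<exists>K'. ?P (Suc k) K' \<and> ?Q k K K'" using K by blast
  qed
  then obtain K where K: "\<And>k. ?P k (K k)" "\<And>k. ?Q k (K k) (K (Suc k))" by metis
  show thesis
  proof
    show "K 0 = K0" "compact (K k)" for k using K(1) by auto
    show "K (Suc k) \<subseteq> K k" "\<exists>n>k. K (Suc k) \<subseteq> cos_nonneg_set n" for k using K(2)[of k] by blast+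
  qed (use K(2) in blast)
qed

lemma halving_step_mass:
  fixes x y m :: real
  assumes "\<bar>2 * y - x\<bar> \<le> m * (1 / 2) ^ (l + 2 * k + 2)"
  shows "\<bar>2 ^ Suc k * y - 2 ^ k * x\<bar> \<le> m * (1 / 2) ^ (l + k + 2)"
proof -
  have "2 ^ Suc k * y - 2 ^ k * x = 2 ^ k * (2 * y - x)" by (simp add: algebra_simps)
  then have "\<bar>2 ^ Suc k * y - 2 ^ k * x\<bar> = 2 ^ k * \<bar>2 * y - x\<bar>" by (simp add: abs_mult)
  also have "\<dots> \<le> 2 ^ k * (m * (1 / 2) ^ (l + 2 * k + 2))" using assms by (intro mult_left_mono) auto
  also have "\<dots> = m * (1 / 2) ^ (l + k + 2)"
  proof -
    have "(1 / 2 :: real) ^ (l + 2 * k + 2) = (1 / 2) ^ k * (1 / 2) ^ (l + k + 2)"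
      by (simp only: power_add[symmetric]) (simp add: mult_2 add_ac)
    then show ?thesis by (simp add: power_one_over)
  qed
  finally show ?thesis .
qed

text \<open>The normalised mass loses at most the fraction \<open>(1 / 2) ^ (k + 2)\<close> of the
  initial mass in step \<open>k\<close>, altogether at most half. The total is read off the cell
  \<open>dyadic 0 0\<close>, the unit interval.\<close>

lemma halving_mass_lower:
  fixes L :: "nat \<Rightarrow> nat"
  assumes K: "K 0 \<subseteq> {0..1}" "\<And>k. K (Suc k) \<subseteq> K k"
    and halving: "\<And>k. \<bar>2 * measure lborel (K (Suc k) \<inter> dyadic 0 0) - measure lborel (K k \<inter> dyadic 0 0)\<bar>
        \<le> measure lborel (K 0) * (1 / 2) ^ (L k + 2 * k + 2)"
  shows "measure lborel (K 0) * (1 / 2 + (1 / 2) ^ Suc k) \<le> 2 ^ k * measure lborel (K k)"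
proof (induction k)
  case (Suc k)
  have sub: "K k \<subseteq> {0..1}" for k by (induction k) (use K in blast)+
  have "K k \<inter> dyadic 0 0 = K k" for k using sub[of k] by (auto simp: dyadic_def)
  then have "\<bar>2 ^ Suc k * measure lborel (K (Suc k)) - 2 ^ k * measure lborel (K k)\<bar>
      \<le> measure lborel (K 0) * (1 / 2) ^ (L k + k + 2)"
    using halving_step_mass[OF halving[of k]] by simp
  also have "\<dots> \<le> measure lborel (K 0) * (1 / 2) ^ (k + 2)"
    by (intro mult_left_mono power_decreasing) auto
  finally have "2 ^ Suc k * measure lborel (K (Suc k))
      \<ge> 2 ^ k * measure lborel (K k) - measure lborel (K 0) * (1 / 2) ^ (k + 2)" by linarith
  moreover have "measure lborel (K 0) * (1 / 2 + (1 / 2) ^ Suc k) - measure lborel (K 0) * (1 / 2) ^ (k + 2)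
      = measure lborel (K 0) * (1 / 2 + (1 / 2) ^ Suc (Suc k))"
    by (simp add: algebra_simps)
  ultimately show ?case using Suc by linarith
qed simp

text \<open>A step with \<open>l \<le> L k\<close> adds at most \<open>(1 / 2) ^ (l + Suc k)\<close>
  to the normalised mass of the cell, a geometric series in \<open>k\<close>. A step with
  \<open>l > L k\<close> is bounded afresh: the cell's length times \<open>2 ^ Suc k\<close> is at
  most \<phi> of its length.\<close>

lemma halving_mass_upper:
  fixes L :: "nat \<Rightarrow> nat"
  assumes borel: "\<And>k. K k \<in> sets borel" and "measure lborel (K 0) \<le> 1"
    and nonneg: "\<And>r. r \<ge> 0 \<Longrightarrow> \<phi> r \<ge> 0"
    and L: "\<And>k r. \<lbrakk>0 < r; r \<le> (1 / 2) ^ L k\<rbrakk> \<Longrightarrow> 2 ^ Suc k * r \<le> \<phi> r"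
    and halving: "\<And>k l i. \<lbrakk>l \<le> L k; i \<le> 2 ^ l\<rbrakk> \<Longrightarrow>
      \<bar>2 * measure lborel (K (Suc k) \<inter> dyadic l i) - measure lborel (K k \<inter> dyadic l i)\<bar>
        \<le> measure lborel (K 0) * (1 / 2) ^ (L k + 2 * k + 2)"
    and i: "i \<le> 2 ^ l"
  shows "2 ^ k * measure lborel (K k \<inter> dyadic l i) \<le> \<phi> ((1 / 2) ^ l) + (2 - (1 / 2) ^ k) * (1 / 2) ^ l"
proof (induction k)
  case 0
  show ?case using measure_Int_dyadic_le[OF borel, of 0 l i] nonneg[of "(1 / 2) ^ l"] by simp
next
  case (Suc k)
  show ?case
  proof (cases "l \<le> L k")
    case True
    have "measure lborel (K 0) * (1 / 2) ^ (L k + k + 2) \<le> 1 * (1 / 2) ^ (l + Suc k)"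
      using assms(2) True by (intro mult_mono power_decreasing) auto
    moreover have "(2 - (1 / 2) ^ k) * (1 / 2) ^ l + 1 * (1 / 2) ^ (l + Suc k) = (2 - (1 / 2) ^ Suc k) * (1 / 2 :: real) ^ l"
      by (simp add: algebra_simps power_add)
    ultimately show ?thesis
      using Suc halving_step_mass[OF halving[OF True i]] by linarith
  next
    case False
    have "2 ^ Suc k * measure lborel (K (Suc k) \<inter> dyadic l i) \<le> 2 ^ Suc k * (1 / 2) ^ l"
      by (intro mult_left_mono measure_Int_dyadic_le borel) auto
    also have "\<dots> \<le> \<phi> ((1 / 2) ^ l)"
      using False by (intro L power_decreasing) auto
    also have "\<dots> \<le> \<phi> ((1 / 2) ^ l) + (2 - (1 / 2) ^ Suc k) * (1 / 2) ^ l"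
      using power_le_one[of "1 / 2 :: real" "Suc k"] by simp
    finally show ?thesis .
  qed
qed

lemma gauge_threshold:
  assumes "\<And>r. r > 0 \<Longrightarrow> \<phi> r > 0" "((\<lambda>r. r / \<phi> r) \<longlongrightarrow> 0) (at_right (0::real))" "c > 0"
  obtains l :: nat where "\<And>r. \<lbrakk>0 < r; r \<le> (1 / 2) ^ l\<rbrakk> \<Longrightarrow> c * r \<le> \<phi> r"
proof -
  have "\<forall>\<^sub>F r in at_right 0. r / \<phi> r < 1 / c"
    using assms(2,3) by (intro order_tendstoD) auto
  then obtain d where d: "d > 0" "\<And>r. \<lbrakk>0 < r; r < d\<rbrakk> \<Longrightarrow> r / \<phi> r < 1 / c"
    by (auto simp: eventually_at_right_field)
  obtain l where l: "(1 / 2 :: real) ^ l < d" using real_arch_pow_inv[OF d(1), of "1/2"] by auto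
  show thesis
  proof
    fix r :: real assume r: "0 < r" "r \<le> (1 / 2) ^ l"
    then have "r / \<phi> r < 1 / c" using l by (intro d(2)) auto
    then show "c * r \<le> \<phi> r" using assms(1)[OF r(1)] assms(3) by (simp add: field_simps)
  qed
qed

(* Positivity of \<phi> on (0,\<infinity>) is implicit in r / \<phi> r \<rightarrow> 0 being meaningful; it is stated because
   r / 0 = 0 in HOL. *)
theorem theorem1p4:
  fixes \<phi> :: "real \<Rightarrow> real"
  assumes "\<phi> \<in> {0..} \<rightarrow> {0..}"
    and "mono_on {0..} \<phi>"
    and "continuous_on {0..} \<phi>"
    and "\<phi> 0 = 0"
    and "\<And>r. r > 0 \<Longrightarrow> \<phi> r > 0"
    and "((\<lambda>r. r / \<phi> r) \<longlongrightarrow> 0) (at_right 0)"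
  shows "\<exists>K. compact K \<and> K \<subseteq> {0..1} \<and> hausdorff_measure \<phi> K > 0 \<and>
           absolutely_normal_set_of_uniqueness K"
proof -
  have nonneg: "\<phi> r \<ge> 0" if "r \<ge> 0" for r using assms(1) that by (auto simp: Pi_iff)
  have mono: "\<phi> r \<le> \<phi> s" if "0 \<le> r" "r \<le> s" for r s
    using assms(2) that by (auto simp: mono_on_def)
  have "\<exists>l. \<forall>r. 0 < r \<longrightarrow> r \<le> (1 / 2) ^ l \<longrightarrow> 2 ^ Suc k * r \<le> \<phi> r" for k :: nat
    using gauge_threshold[OF assms(5,6), of "2 ^ Suc k"] by (metis zero_less_numeral zero_less_power)
  then obtain L :: "nat \<Rightarrow> nat" where
    L: "\<And>k r. \<lbrakk>0 < r; r \<le> (1 / 2) ^ L k\<rbrakk> \<Longrightarrow> 2 ^ Suc k * r \<le> \<phi> r"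
    by metis
  obtain K0 where K0: "compact K0" "K0 \<subseteq> {0..1}" "K0 \<subseteq> absolutely_normal_numbers" "measure lborel K0 > 0"
    by (rule compact_absolutely_normal)
  obtain K where K: "K 0 = K0" "\<And>k. compact (K k)" "\<And>k. K (Suc k) \<subseteq> K k"
    and freq: "\<And>k. \<exists>n>k. K (Suc k) \<subseteq> cos_nonneg_set n"
    and halving: "\<And>k l i. \<lbrakk>l \<le> L k; i \<le> 2 ^ l\<rbrakk> \<Longrightarrow>
      \<bar>2 * measure lborel (K (Suc k) \<inter> dyadic l i) - measure lborel (K k \<inter> dyadic l i)\<bar>
        \<le> measure lborel (K 0) * (1 / 2) ^ (L k + 2 * k + 2)"
    by (rule halving_construction[OF K0(1,2,4), of L]) blast
  define E where "E = (\<Inter>k. K k)"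
  have E_sub: "E \<subseteq> K k" for k by (auto simp: E_def)
  have "E \<subseteq> {0..1}" "E \<subseteq> absolutely_normal_numbers" using E_sub[of 0] K(1) K0 by auto
  have "compact E"
    unfolding E_def using K(2) by (intro compact_Inter) auto
  have borel: "K k \<in> sets borel" for k using K(2) by (rule borel_compact)
  have sub: "K k \<subseteq> {0..1}" for k by (induction k) (use K K0 in blast)+
  have "measure lborel (K 0) \<le> measure lborel {0..1::real}"
    using sub[of 0] borel by (intro measure_lborel_mono) auto
  then have le_1: "measure lborel (K 0) \<le> 1" by simp
  \<comment> \<open>Intervals shorter than \<eta> lead to cells below the scale
    \<open>(1 / 2) ^ L 0\<close>, where \<phi> absorbs the linear term
    \<open>2 * (1 / 2) ^ l\<close>.\<close>
  define \<eta> :: real where "\<eta> = (1 / 2) ^ Suc (L 0)"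
  have "hausdorff_measure \<phi> (\<Inter>k. K k) > 0"
  \<comment> \<open>The constant 6 stands for three cells of normalised mass at most
    \<open>2 * \<phi> (b - a)\<close> each.\<close>
  proof (rule hausdorff_measure_pos[where w = "\<lambda>k. 2 ^ k" and c = "measure lborel K0 / 2" and C = 6 and \<eta> = \<eta>])
    show "measure lborel K0 / 2 \<le> 2 ^ k * measure lborel (K k)" for k
    proof -
      have "measure lborel K0 / 2 \<le> measure lborel (K 0) * (1 / 2 + (1 / 2) ^ Suc k)"
        using K by (simp add: algebra_simps)
      also have "\<dots> \<le> 2 ^ k * measure lborel (K k)"
        using K K0 halving by (intro halving_mass_lower[of K L]) auto
      finally show ?thesis .
    qed
    fix k and a b :: real
    assume ab: "a < b" "b - a < \<eta>"
    have "\<eta> \<le> 1" unfolding \<eta>_def by (rule power_le_one) auto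
    then obtain l I where lI: "(1 / 2) ^ l \<le> b - a" "finite I" "card I \<le> 3" "I \<subseteq> {..2 ^ l}"
      "{a..b} \<inter> {0..1} \<subseteq> (\<Union>i\<in>I. dyadic l i)"
      using Icc_subset_three_dyadics[of b a] ab by (metis diff_gt_0_iff_gt order_less_le_trans)
    have "measure lborel (K k \<inter> {a..b}) \<le> measure lborel (\<Union>i\<in>I. K k \<inter> dyadic l i)"
    proof (rule measure_lborel_mono)
      show "K k \<inter> {a..b} \<subseteq> (\<Union>i\<in>I. K k \<inter> dyadic l i)" using lI(5) sub[of k] by blast
      show "bounded (\<Union>i\<in>I. K k \<inter> dyadic l i)"
        by (rule bounded_subset[OF compact_imp_bounded[OF K(2)]]) blast
    qed (use borel lI(2) in \<open>auto simp: dyadic_def\<close>)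
    also have "\<dots> \<le> (\<Sum>i\<in>I. measure lborel (K k \<inter> dyadic l i))"
      using lI borel by (intro measure_UNION_le) (auto simp: dyadic_def)
    finally have "2 ^ k * measure lborel (K k \<inter> {a..b}) \<le> (\<Sum>i\<in>I. 2 ^ k * measure lborel (K k \<inter> dyadic l i))"
      by (simp add: sum_distrib_left[symmetric])
    also have "\<dots> \<le> (\<Sum>i\<in>I. 2 * \<phi> (b - a))"
    proof (rule sum_mono)
      fix i assume "i \<in> I"
      then have "2 ^ k * measure lborel (K k \<inter> dyadic l i) \<le> \<phi> ((1 / 2) ^ l) + (2 - (1 / 2) ^ k) * (1 / 2) ^ l"
        using lI(4) by (intro halving_mass_upper[of K \<phi> L] borel le_1 nonneg L halving) auto
      also have "\<dots> \<le> \<phi> ((1 / 2) ^ l) + 2 ^ Suc 0 * (1 / 2) ^ l"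
        by (intro add_left_mono mult_right_mono) auto
      also have "\<dots> \<le> \<phi> ((1 / 2) ^ l) + \<phi> ((1 / 2) ^ l)"
      proof (intro add_left_mono L)
        have "\<eta> \<le> (1 / 2) ^ L 0" by (simp add: \<eta>_def)
        then show "(1 / 2) ^ l \<le> (1 / 2 :: real) ^ L 0" using lI(1) ab by linarith
      qed simp
      also have "\<dots> \<le> 2 * \<phi> (b - a)" using mono[OF _ lI(1)] by simp
      finally show "2 ^ k * measure lborel (K k \<inter> dyadic l i) \<le> 2 * \<phi> (b - a)" .
    qed
    also have "\<dots> \<le> 3 * (2 * \<phi> (b - a))"
      using lI(3) nonneg[of "b - a"] ab by (simp add: mult_right_mono)
    finally show "2 ^ k * measure lborel (K k \<inter> {a..b}) \<le> 6 * \<phi> (b - a)" by simp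
  qed (use assms(3) nonneg K K0 in \<open>auto simp: \<eta>_def\<close>)
  moreover have "set_of_uniqueness E"
  proof (rule set_of_uniqueness_if_cos_nonneg)
    show "\<exists>n>B. E \<subseteq> {x. cos (2 * pi * real n * x) \<ge> 0}" for B
      using freq[of B] E_sub[of "Suc B"] unfolding cos_nonneg_set_def by blast
  qed fact
  \<comment> \<open>This makes the density and dimension conditions trivial.\<close>
  moreover have "E \<inter> absolutely_normal_numbers = E" using \<open>E \<subseteq> absolutely_normal_numbers\<close> by blast
  ultimately show ?thesis
    using \<open>compact E\<close> \<open>E \<subseteq> {0..1}\<close>
    by (intro exI[of _ E]) (auto simp: absolutely_normal_set_of_uniqueness_def E_def Int_commute intro: closure_subset[THEN subsetD])
qed

end
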